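(* Let $\Delta = (\Gamma,(X_a),(G(v)))$ be a local action diagram, let $\mathbf{T} = (T,\mathcal{L},\pi)$ be a $\Delta$-tree, and let $\mathbf{U}(\Delta) = \mathbf{U}_{\mathbf{T}}(\Delta) \leq \operatorname{Aut}(T)$ be the universal group of $\Delta$ and $\mathbf{T}$. Then for every group $G \leq \operatorname{Aut}(T)$ whose associated local action diagram is $\Delta$ (up to isomorphism of local action diagrams), the group $\mathbf{U}(\Delta)$ contains a permutationally isomorphic copy of $G$; that is, there is a subgroup $H \leq \mathbf{U}(\Delta)$ such that the action of $H$ on $VT$ is permutationally isomorphic to the action of $G$ on $VT$.
   Context: **Graphs.** A graph $\Gamma$ consists of a vertex set $V\Gamma$, an arc set $A\Gamma$ (each finite or infinite), an involutory arc-reversal map $a \mapsto \overline{a}$ on $A\Gamma$, and maps $o,t : A\Gamma \to V\Gamma$ (origin and terminus) with $t(a) = o(\overline{a})$. Multiple edges and loops (arcs with $o(a)=t(a)$) are allowed, and a loop $a$ may or may not satisfy $a=\overline{a}$. Edges are the pairs $\{a,\overline{a}\}$. A graph is simple if it has no loops and at most one edge between any two vertices. A tree is a nonempty simple connected graph with no cycles; it need not be locally finite. A graph homomorphism is a pair of maps on vertices and arcs that respects origins and arc reversal; it is an isomorphism if both maps are bijections. For a tree $T$, $\operatorname{Aut}(T)$ is identified with a subgroup of $\operatorname{Sym}(VT)$. If a group $G$ acts on $\Gamma$, the quotient graph $G\backslash\Gamma$ has as vertices and arcs the $G$-orbits on $V\Gamma$ and $A\Gamma$, with $o(Ga)=Go(a)$,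 $t(Ga)=Gt(a)$, $\overline{Ga}=G\overline{a}$. **Topology.** $\operatorname{Sym}(X)$ carries the permutation topology: pointwise stabilisers of finite subsets of $X$ form a neighbourhood basis of the identity. "Closed" and "closure" refer to this topology. **Permutational isomorphism.** $G \leq \operatorname{Sym}(X)$ and $H \leq \operatorname{Sym}(Y)$ are permutationally isomorphic if there is a bijection $\phi : X \to Y$ with $\phi G \phi^{-1} = H$. **Local action diagram.** A local action diagram $\Delta = (\Gamma,(X_a),(G(v)))$ consists of: 1. a nonempty connected graph $\Gamma$; 2. a nonempty set $X_a$ (of colours) for each $a \in A\Gamma$, the sets for distinct arcs being disjoint; for $v \in V\Gamma$ put $X_v := \bigsqcup_{a \in o^{-1}(v)} X_a$; 3. a closed group $G(v) \leq \operatorname{Sym}(X_v)$ for each $v \in V\Gamma$, such that the sets $X_a$ ($a \in o^{-1}(v)$) are the orbits of $G(v)$ on $X_v$. An isomorphism from $(\Gamma,(X_a),(G(v)))$ to $(\Gamma',(X'_a),(G'(v)))$ consists of a graph isomorphism $\theta : \Gamma \to \Gamma'$ and bijections $\theta_v : X_v \to X'_{\theta(v)}$ for each $v\in V\Gamma$, restricting to bijections $X_a \to X'_{\theta(a)}$ for each $a \in o^{-1}(v)$, with $\theta_v G(v) \theta_v^{-1} = G'(\theta(v))$. **Associated local action diagram.** Let $T$ be a tree and $G \leq \operatorname{Aut}(T)$. Take $\Gamma := G\backslash T$ with quotient map $\pi$. For each $v \in V\Gamma$ choose a representative $v^* \in VT$ with $\pi(v^* ) = v$. Put $X_v := o^{-1}(v^*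 )$, the set of arcs of $T$ with origin $v^*$, and for $a \in o^{-1}(v)$ put $X_a := \{b \in o^{-1}(v^* ) : \pi(b) = a\}$. Let $G(v)$ be the closure in $\operatorname{Sym}(X_v)$ of the permutation group induced on $X_v$ by the stabiliser $G_{v^*}$. The result is a local action diagram, called the associated local action diagram of $G$ (or of $(T,G)$); different choices of representatives give isomorphic diagrams, so it is well defined up to isomorphism. **$\Delta$-tree.** For a local action diagram $\Delta = (\Gamma,(X_a),(G(v)))$, a $\Delta$-tree $\mathbf{T} = (T,\mathcal{L},\pi)$ consists of a tree $T$, a surjective graph homomorphism $\pi : T \to \Gamma$, and a map $\mathcal{L} : AT \to \bigsqcup_{a \in A\Gamma} X_a$ such that for every $v \in VT$ and every $a \in o^{-1}(\pi(v))$, $\mathcal{L}$ restricts to a bijection from $\{b \in o^{-1}(v) : \pi(b) = a\}$ to $X_a$. In particular $\mathcal{L}|_{o^{-1}(v)}$ is a bijection from $o^{-1}(v)$ to $X_{\pi(v)}$. **Universal group.** Let $\operatorname{Aut}_\pi(T) := \{g \in \operatorname{Aut}(T) : \pi \circ g = \pi\}$. For $g \in \operatorname{Aut}_\pi(T)$ and $v \in VT$ define $\sigma_{\mathcal{L},v}(g) := \mathcal{L}|_{o^{-1}(gv)} \, g \, (\mathcal{L}|_{o^{-1}(v)})^{-1} \in \operatorname{Sym}(X_{\pi(v)})$. The universal group is $$\mathbf{U}_{\mathbf{T}}(\Delta) := \{ g \in \operatorname{Aut}_\pi(T) : \sigma_{\mathcal{L},v}(g) \in G(\pi(v)) \text{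 for all } v \in VT \},$$ also written $\mathbf{U}(\Delta)$. *)

theory Defs
  imports "HOL-Algebra.Group_Action" "HOL-Analysis.Abstract_Topology"
begin

section \<open>Graphs\<close>

record ('v, 'a) graph =
  verts :: "'v set"
  arcs :: "'a set"
  orig :: "'a \<Rightarrow> 'v"
  arev :: "'a \<Rightarrow> 'a"

definition wf_graph :: "('v, 'a) graph \<Rightarrow> bool" where
  "wf_graph \<Gamma> \<longleftrightarrow>
     (\<forall>a\<in>arcs \<Gamma>. orig \<Gamma> a \<in> verts \<Gamma> \<and> arev \<Gamma> a \<in> arcs \<Gamma> \<and> arev \<Gamma> (arev \<Gamma> a) = a)"

definition terminus :: "('v, 'a) graph \<Rightarrow> 'a \<Rightarrow> 'v" where
  "terminus \<Gamma> a = orig \<Gamma> (arev \<Gamma> a)"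

definition out_arcs :: "('v, 'a) graph \<Rightarrow> 'v \<Rightarrow> 'a set" where
  "out_arcs \<Gamma> v = {a \<in> arcs \<Gamma>. orig \<Gamma> a = v}"

definition simple_graph :: "('v, 'a) graph \<Rightarrow> bool" where
  "simple_graph \<Gamma> \<longleftrightarrow> wf_graph \<Gamma> \<and>
     (\<forall>a\<in>arcs \<Gamma>. orig \<Gamma> a \<noteq> terminus \<Gamma> a) \<and>
     (\<forall>a\<in>arcs \<Gamma>. \<forall>b\<in>arcs \<Gamma>. {orig \<Gamma> a, terminus \<Gamma> a} = {orig \<Gamma> b, terminus \<Gamma> b} \<longrightarrow>
        {a, arev \<Gamma> a} = {b, arev \<Gamma> b})"

fun walk :: "('v, 'a) graph \<Rightarrow> 'v \<Rightarrow> 'a list \<Rightarrow> 'v \<Rightarrow> bool" where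
  "walk \<Gamma> u [] v \<longleftrightarrow> u \<in> verts \<Gamma> \<and> u = v"
| "walk \<Gamma> u (a # p) v \<longleftrightarrow> a \<in> arcs \<Gamma> \<and> orig \<Gamma> a = u \<and> walk \<Gamma> (terminus \<Gamma> a) p v"

definition connected_graph :: "('v, 'a) graph \<Rightarrow> bool" where
  "connected_graph \<Gamma> \<longleftrightarrow> (\<forall>u\<in>verts \<Gamma>. \<forall>v\<in>verts \<Gamma>. \<exists>p. walk \<Gamma> u p v)"

text \<open>
  Cycles are only considered in simple graphs, where they have at least three arcs; the bound
  excludes traversing an edge back and forth.
\<close>

definition is_cycle :: "('v, 'a) graph \<Rightarrow> 'a list \<Rightarrow> bool" where
  "is_cycle \<Gamma> p \<longleftrightarrow> (\<exists>v. walk \<Gamma> v p v) \<and> length p \<ge> 3 \<and> distinct (map (orig \<Gamma>) p)"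

definition is_tree :: "('v, 'a) graph \<Rightarrow> bool" where
  "is_tree T \<longleftrightarrow> simple_graph T \<and> verts T \<noteq> {} \<and> connected_graph T \<and> (\<nexists>p. is_cycle T p)"

definition graph_hom ::
  "('v, 'a) graph \<Rightarrow> ('w, 'b) graph \<Rightarrow> ('v \<Rightarrow> 'w) \<Rightarrow> ('a \<Rightarrow> 'b) \<Rightarrow> bool" where
  "graph_hom \<Gamma> \<Gamma>' \<theta>\<^sub>V \<theta>\<^sub>A \<longleftrightarrow>
     \<theta>\<^sub>V \<in> verts \<Gamma> \<rightarrow> verts \<Gamma>' \<and> \<theta>\<^sub>A \<in> arcs \<Gamma> \<rightarrow> arcs \<Gamma>' \<and>
     (\<forall>a\<in>arcs \<Gamma>. orig \<Gamma>' (\<theta>\<^sub>A a) = \<theta>\<^sub>V (orig \<Gamma> a) \<and> arev \<Gamma>' (\<theta>\<^sub>A a) = \<theta>\<^sub>A (arev \<Gamma> a))"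

definition graph_iso ::
  "('v, 'a) graph \<Rightarrow> ('w, 'b) graph \<Rightarrow> ('v \<Rightarrow> 'w) \<Rightarrow> ('a \<Rightarrow> 'b) \<Rightarrow> bool" where
  "graph_iso \<Gamma> \<Gamma>' \<theta>\<^sub>V \<theta>\<^sub>A \<longleftrightarrow> graph_hom \<Gamma> \<Gamma>' \<theta>\<^sub>V \<theta>\<^sub>A \<and>
     bij_betw \<theta>\<^sub>V (verts \<Gamma>) (verts \<Gamma>') \<and> bij_betw \<theta>\<^sub>A (arcs \<Gamma>) (arcs \<Gamma>')"

text \<open>
  Automorphisms of a tree are identified with permutations of its vertex set; the
  action on arcs is recovered by \<open>arc_map\<close>, which is well defined for simple graphs
  (lemma \<open>arc_map_unique\<close> below).
\<close>

definition graph_aut :: "('v, 'a) graph \<Rightarrow> ('v \<Rightarrow> 'v) set" where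
  "graph_aut T = {g \<in> Bij (verts T). \<exists>h. graph_iso T T g h}"

definition arc_map :: "('v, 'a) graph \<Rightarrow> ('v \<Rightarrow> 'v) \<Rightarrow> 'a \<Rightarrow> 'a" where
  "arc_map T g = (THE h. h \<in> extensional (arcs T) \<and> graph_iso T T g h)"

lemma simple_graph_arc_eqI:
  assumes "simple_graph T" "a \<in> arcs T" "b \<in> arcs T"
    and "orig T a = orig T b" "terminus T a = terminus T b"
  shows "a = b"
proof -
  have "{orig T a, terminus T a} = {orig T b, terminus T b}"
    using assms(4,5) by simp
  then have "{a, arev T a} = {b, arev T b}"
    using assms(1-3) unfolding simple_graph_def by blast
  moreover have "a \<noteq> arev T b"
    using assms(1,3,4) unfolding simple_graph_def terminus_def by metis
  ultimately show ?thesis by (simp add: doubleton_eq_iff)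
qed

lemma arc_map_unique:
  assumes "simple_graph T" "g \<in> graph_aut T"
  shows "\<exists>!h. h \<in> extensional (arcs T) \<and> graph_iso T T g h"
proof -
  have wf: "arev T a \<in> arcs T" if "a \<in> arcs T" for a
    using assms(1) that by (auto simp: simple_graph_def wf_graph_def)
  obtain h where h: "graph_iso T T g h"
    using assms(2) by (auto simp: graph_aut_def)
  show ?thesis
  proof (rule ex1I)
    show "restrict h (arcs T) \<in> extensional (arcs T) \<and> graph_iso T T g (restrict h (arcs T))"
      using h wf by (simp add: graph_iso_def graph_hom_def Pi_def)
  next
    fix k assume k: "k \<in> extensional (arcs T) \<and> graph_iso T T g k"
    show "k = restrict h (arcs T)"
    proof (rule extensionalityI[where A = "arcs T"])
      fix a assume a: "a \<in> arcs T"
      have "k a = h a"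
        using h k a wf[OF a]
        by (intro simple_graph_arc_eqI[OF assms(1)])
           (auto simp: graph_iso_def graph_hom_def terminus_def Pi_def)
      then show "k a = restrict h (arcs T) a" using a by simp
    qed (use k in auto)
  qed
qed


section \<open>Permutation groups\<close>

text \<open>
  Permutations of \<open>X\<close> are extensional bijections, \<open>Sym(X)\<close> is \<^term>\<open>BijGroup X\<close>, and a permutation
  group on \<open>X\<close> is a subset \<open>G\<close> with \<^prop>\<open>subgroup G (BijGroup X)\<close>.
\<close>

abbreviation perm_group :: "'x set \<Rightarrow> ('x \<Rightarrow> 'x) set \<Rightarrow> ('x \<Rightarrow> 'x) monoid" where
  "perm_group X G \<equiv> (BijGroup X)\<lparr>carrier := G\<rparr>"

definition pointwise_stabilizer :: "'x set \<Rightarrow> 'x set \<Rightarrow> ('x \<Rightarrow> 'x) set" where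
  "pointwise_stabilizer X F = {g \<in> Bij X. \<forall>x\<in>F. g x = x}"

definition perm_topology :: "'x set \<Rightarrow> ('x \<Rightarrow> 'x) topology" where
  "perm_topology X = topology (\<lambda>U. U \<subseteq> Bij X \<and>
     (\<forall>g\<in>U. \<exists>F. finite F \<and> F \<subseteq> X \<and> g <#\<^bsub>BijGroup X\<^esub> pointwise_stabilizer X F \<subseteq> U))"

lemma openin_perm_topology:
  "openin (perm_topology X) U \<longleftrightarrow> U \<subseteq> Bij X \<and>
     (\<forall>g\<in>U. \<exists>F. finite F \<and> F \<subseteq> X \<and> g <#\<^bsub>BijGroup X\<^esub> pointwise_stabilizer X F \<subseteq> U)"
proof -
  define N where "N g F = g <#\<^bsub>BijGroup X\<^esub> pointwise_stabilizer X F" for g F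
  define P where "P U \<longleftrightarrow> U \<subseteq> Bij X \<and> (\<forall>g\<in>U. \<exists>F. finite F \<and> F \<subseteq> X \<and> N g F \<subseteq> U)" for U
  have mono: "N g F' \<subseteq> N g F" if "F \<subseteq> F'" for g F F'
    using that by (fastforce simp: N_def l_coset_def pointwise_stabilizer_def)
  have "P (S \<inter> S')" if S: "P S" and S': "P S'" for S S'
    unfolding P_def
  proof (intro conjI ballI)
    show "S \<inter> S' \<subseteq> Bij X" using S by (auto simp: P_def)
    fix g assume g: "g \<in> S \<inter> S'"
    obtain F where F: "finite F" "F \<subseteq> X" "N g F \<subseteq> S"
      using S g unfolding P_def by blast
    obtain F' where F': "finite F'" "F' \<subseteq> X" "N g F' \<subseteq> S'"
      using S' g unfolding P_def by blast
    have "N g (F \<union> F') \<subseteq> S \<inter> S'"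
      using mono[of F "F \<union> F'" g] mono[of F' "F \<union> F'" g] F(3) F'(3) by blast
    then show "\<exists>F. finite F \<and> F \<subseteq> X \<and> N g F \<subseteq> S \<inter> S'"
      using F(1,2) F'(1,2) by (intro exI[of _ "F \<union> F'"]) simp
  qed
  moreover have "P (\<Union>K)" if K: "\<forall>S\<in>K. P S" for K
    unfolding P_def
  proof (intro conjI ballI)
    show "\<Union>K \<subseteq> Bij X" using K by (auto simp: P_def)
    fix g assume "g \<in> \<Union>K"
    then obtain S where S: "S \<in> K" "g \<in> S" by blast
    with K have "P S" by blast
    with S(2) obtain F where "finite F" "F \<subseteq> X" "N g F \<subseteq> S" unfolding P_def by blast
    with S(1) have "finite F \<and> F \<subseteq> X \<and> N g F \<subseteq> \<Union>K" by blast
    then show "\<exists>F. finite F \<and> F \<subseteq> X \<and> N g F \<subseteq> \<Union>K" ..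
  qed
  ultimately have "istopology P"
    unfolding istopology_def by simp
  moreover have "perm_topology X = topology P"
    by (simp add: perm_topology_def P_def [abs_def] N_def)
  ultimately have "openin (perm_topology X) U \<longleftrightarrow> P U"
    by simp
  then show ?thesis
    by (simp add: P_def N_def)
qed

lemma topspace_perm_topology [simp]: "topspace (perm_topology X) = Bij X"
proof
  have "g <#\<^bsub>BijGroup X\<^esub> pointwise_stabilizer X {} \<subseteq> Bij X" if "g \<in> Bij X" for g
    using that by (auto simp: l_coset_def pointwise_stabilizer_def BijGroup_def compose_Bij)
  then have "openin (perm_topology X) (Bij X)"
    unfolding openin_perm_topology by (metis empty_subsetI finite.emptyI order_refl)
  then show "Bij X \<subseteq> topspace (perm_topology X)"
    by (rule openin_subset)
  show "topspace (perm_topology X) \<subseteq> Bij X"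
    using openin_topspace[of "perm_topology X"] unfolding openin_perm_topology by simp
qed

text \<open>\<open>\<phi> g \<phi>\<inverse>\<close> for a bijection \<open>\<phi>\<close> from \<open>X\<close> to \<open>Y\<close>.\<close>

definition conj_perm :: "('x \<Rightarrow> 'y) \<Rightarrow> 'x set \<Rightarrow> 'y set \<Rightarrow> ('x \<Rightarrow> 'x) \<Rightarrow> 'y \<Rightarrow> 'y" where
  "conj_perm \<phi> X Y g = (\<lambda>y\<in>Y. \<phi> (g (inv_into X \<phi> y)))"

definition perm_isomorphic ::
  "'x set \<Rightarrow> ('x \<Rightarrow> 'x) set \<Rightarrow> 'y set \<Rightarrow> ('y \<Rightarrow> 'y) set \<Rightarrow> bool" where
  "perm_isomorphic X G Y H \<longleftrightarrow> (\<exists>\<phi>. bij_betw \<phi> X Y \<and> conj_perm \<phi> X Y ` G = H)"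


section \<open>Local action diagrams\<close>

record ('v, 'a, 'x) lad =
  base :: "('v, 'a) graph"
  colours :: "'a \<Rightarrow> 'x set"
  local_group :: "'v \<Rightarrow> ('x \<Rightarrow> 'x) set"

definition vertex_colours :: "('v, 'a, 'x) lad \<Rightarrow> 'v \<Rightarrow> 'x set" where
  "vertex_colours \<Delta> v = (\<Union>a\<in>out_arcs (base \<Delta>) v. colours \<Delta> a)"

definition local_action_diagram :: "('v, 'a, 'x) lad \<Rightarrow> bool" where
  "local_action_diagram \<Delta> \<longleftrightarrow>
     wf_graph (base \<Delta>) \<and> verts (base \<Delta>) \<noteq> {} \<and> connected_graph (base \<Delta>) \<and>
     (\<forall>a\<in>arcs (base \<Delta>). colours \<Delta> a \<noteq> {}) \<and>
     (\<forall>a\<in>arcs (base \<Delta>). \<forall>b\<in>arcs (base \<Delta>). a \<noteq> b \<longrightarrow> colours \<Delta> a \<inter> colours \<Delta> b = {}) \<and>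
     (\<forall>v\<in>verts (base \<Delta>).
        subgroup (local_group \<Delta> v) (BijGroup (vertex_colours \<Delta> v)) \<and>
        closedin (perm_topology (vertex_colours \<Delta> v)) (local_group \<Delta> v) \<and>
        orbits (perm_group (vertex_colours \<Delta> v) (local_group \<Delta> v)) (vertex_colours \<Delta> v) (\<lambda>g. g)
          = colours \<Delta> ` out_arcs (base \<Delta>) v)"

definition lad_isomorphic :: "('v, 'a, 'x) lad \<Rightarrow> ('w, 'b, 'y) lad \<Rightarrow> bool" where
  "lad_isomorphic \<Delta> \<Delta>' \<longleftrightarrow>
     (\<exists>\<theta>\<^sub>V \<theta>\<^sub>A \<phi>. graph_iso (base \<Delta>) (base \<Delta>') \<theta>\<^sub>V \<theta>\<^sub>A \<and>
        (\<forall>v\<in>verts (base \<Delta>).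
           bij_betw (\<phi> v) (vertex_colours \<Delta> v) (vertex_colours \<Delta>' (\<theta>\<^sub>V v)) \<and>
           (\<forall>a\<in>out_arcs (base \<Delta>) v. bij_betw (\<phi> v) (colours \<Delta> a) (colours \<Delta>' (\<theta>\<^sub>A a))) \<and>
           conj_perm (\<phi> v) (vertex_colours \<Delta> v) (vertex_colours \<Delta>' (\<theta>\<^sub>V v)) ` local_group \<Delta> v
             = local_group \<Delta>' (\<theta>\<^sub>V v)))"


section \<open>The associated local action diagram\<close>

definition vertex_orbit :: "('v, 'a) graph \<Rightarrow> ('v \<Rightarrow> 'v) set \<Rightarrow> 'v \<Rightarrow> 'v set" where
  "vertex_orbit T G v = orbit (perm_group (verts T) G) (\<lambda>g. g) v"

definition arc_orbit :: "('v, 'a) graph \<Rightarrow> ('v \<Rightarrow> 'v) set \<Rightarrow> 'a \<Rightarrow> 'a set" where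
  "arc_orbit T G a = orbit (perm_group (verts T) G) (arc_map T) a"

text \<open>
  The image under \<^term>\<open>orig T\<close> of the orbit of an arc \<open>a\<close> is the orbit of \<^term>\<open>orig T a\<close>,
  and similarly for arc reversal.
\<close>

definition quotient_graph ::
  "('v, 'a) graph \<Rightarrow> ('v \<Rightarrow> 'v) set \<Rightarrow> ('v set, 'a set) graph" where
  "quotient_graph T G =
     \<lparr>verts = vertex_orbit T G ` verts T, arcs = arc_orbit T G ` arcs T,
      orig = (\<lambda>A. orig T ` A), arev = (\<lambda>A. arev T ` A)\<rparr>"

definition orbit_representatives ::
  "('v, 'a) graph \<Rightarrow> ('v \<Rightarrow> 'v) set \<Rightarrow> ('v set \<Rightarrow> 'v) \<Rightarrow> bool" where
  "orbit_representatives T G s \<longleftrightarrow>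
     (\<forall>v\<in>verts (quotient_graph T G). s v \<in> verts T \<and> vertex_orbit T G (s v) = v)"

definition assoc_lad ::
  "('v, 'a) graph \<Rightarrow> ('v \<Rightarrow> 'v) set \<Rightarrow> ('v set \<Rightarrow> 'v) \<Rightarrow> ('v set, 'a set, 'a) lad" where
  "assoc_lad T G s =
     \<lparr>base = quotient_graph T G,
      colours = (\<lambda>a. {b \<in> out_arcs T (s (orig (quotient_graph T G) a)). arc_orbit T G b = a}),
      local_group = (\<lambda>v. Abstract_Topology.closure_of (perm_topology (out_arcs T (s v)))
        ((\<lambda>g. restrict (arc_map T g) (out_arcs T (s v))) `
           stabilizer (perm_group (verts T) G) (\<lambda>g. g) (s v)))\<rparr>"


section \<open>The universal group\<close>

definition delta_tree ::
  "('w, 'b, 'x) lad \<Rightarrow> ('v, 'a) graph \<Rightarrow> ('a \<Rightarrow> 'x) \<Rightarrow> ('v \<Rightarrow> 'w) \<Rightarrow> ('a \<Rightarrow> 'b) \<Rightarrow> bool" where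
  "delta_tree \<Delta> T \<L> \<pi>\<^sub>V \<pi>\<^sub>A \<longleftrightarrow>
     is_tree T \<and> graph_hom T (base \<Delta>) \<pi>\<^sub>V \<pi>\<^sub>A \<and>
     \<pi>\<^sub>V ` verts T = verts (base \<Delta>) \<and> \<pi>\<^sub>A ` arcs T = arcs (base \<Delta>) \<and>
     \<L> \<in> arcs T \<rightarrow> (\<Union>a\<in>arcs (base \<Delta>). colours \<Delta> a) \<and>
     (\<forall>v\<in>verts T. \<forall>a\<in>out_arcs (base \<Delta>) (\<pi>\<^sub>V v).
        bij_betw \<L> {b \<in> out_arcs T v. \<pi>\<^sub>A b = a} (colours \<Delta> a))"

definition graph_aut_over ::
  "('v, 'a) graph \<Rightarrow> ('v \<Rightarrow> 'w) \<Rightarrow> ('a \<Rightarrow> 'b) \<Rightarrow> ('v \<Rightarrow> 'v) set" where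
  "graph_aut_over T \<pi>\<^sub>V \<pi>\<^sub>A =
     {g \<in> graph_aut T. (\<forall>v\<in>verts T. \<pi>\<^sub>V (g v) = \<pi>\<^sub>V v) \<and> (\<forall>a\<in>arcs T. \<pi>\<^sub>A (arc_map T g a) = \<pi>\<^sub>A a)}"

definition local_action ::
  "('w, 'b, 'x) lad \<Rightarrow> ('v, 'a) graph \<Rightarrow> ('a \<Rightarrow> 'x) \<Rightarrow> ('v \<Rightarrow> 'w) \<Rightarrow> 'v \<Rightarrow> ('v \<Rightarrow> 'v) \<Rightarrow> 'x \<Rightarrow> 'x" where
  "local_action \<Delta> T \<L> \<pi>\<^sub>V v g =
     (\<lambda>x\<in>vertex_colours \<Delta> (\<pi>\<^sub>V v). \<L> (arc_map T g (inv_into (out_arcs T v) \<L> x)))"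

definition universal_group ::
  "('w, 'b, 'x) lad \<Rightarrow> ('v, 'a) graph \<Rightarrow> ('a \<Rightarrow> 'x) \<Rightarrow> ('v \<Rightarrow> 'w) \<Rightarrow> ('a \<Rightarrow> 'b) \<Rightarrow> ('v \<Rightarrow> 'v) set" where
  "universal_group \<Delta> T \<L> \<pi>\<^sub>V \<pi>\<^sub>A =
     {g \<in> graph_aut_over T \<pi>\<^sub>V \<pi>\<^sub>A. \<forall>v\<in>verts T. local_action \<Delta> T \<L> \<pi>\<^sub>V v g \<in> local_group \<Delta> (\<pi>\<^sub>V v)}"

end

theory Submission
  imports Defs
begin

text \<open>
  The orbit map of \<open>G\<close> makes \<open>T\<close> itself a tree over the associated diagram, labelled so that
  \<open>G\<close> lies in the corresponding universal group; through the isomorphism of diagrams this is a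
  second \<open>\<Delta>\<close>-tree structure on \<open>T\<close>. Any two \<open>\<Delta>\<close>-trees are isomorphic by a map that, at each
  vertex, changes labels by an element of the local group, and conjugation by such a map carries
  one universal group into the other.
\<close>

section \<open>Reduced walks\<close>

text \<open>A copy of \<open>G\<close> is needed, rather than \<open>G\<close> itself, because the
  given projection and labelling were chosen without regard to \<open>G\<close>: they need not be
  compatible with its action, whereas the structure built from the orbit map is.

  The obstacle to comparing the two structures is that the label of an arc says nothing about the
  label of the reversed arc beyond its colour set. An isomorphism that preserves labels exactly
  would in general contradict itself at the far end of the first arc. Hence a local permutation is
  allowed at each vertex. This costs nothing: if the isomorphism changes labels at \<open>v\<close>
  by \<gamma>(v), the local action \<tau> of \<open>g\<close> at \<open>v\<close> becomes
  \<gamma>(gv) \<tau> \<gamma>(v)^-1 for the conjugate. As \<open>g\<close> respects the projection,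
  \<open>v\<close> and \<open>gv\<close> lie over the same base vertex, so all three factors belong
  to one local group.

  Trees enter through one fact, that between two vertices there is exactly one walk without
  backtracking. It makes recursion from a root well defined, and it turns a locally bijective
  homomorphism into an isomorphism.\<close>

lemma wf_graphD:
  assumes "wf_graph T" "a \<in> arcs T"
  shows "orig T a \<in> verts T" "terminus T a \<in> verts T" "arev T a \<in> arcs T"
    "arev T (arev T a) = a" "orig T (arev T a) = terminus T a" "terminus T (arev T a) = orig T a"
  using assms by (auto simp: wf_graph_def terminus_def)

lemma walk_start: "wf_graph T \<Longrightarrow> walk T u p v \<Longrightarrow> u \<in> verts T"
  by (cases p) (auto simp: wf_graphD)

lemma walk_append:
  assumes "wf_graph T"
  shows "walk T u (p @ q) v \<longleftrightarrow> (\<exists>w. walk T u p w \<and> walk T w q v)"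
  using walk_start[OF assms] by (induction p arbitrary: u) auto

lemma walk_arcs: "walk T u p v \<Longrightarrow> set p \<subseteq> arcs T"
  by (induction p arbitrary: u) auto

lemma walk_reverse:
  assumes "wf_graph T" "walk T u p v"
  shows "walk T v (rev (map (arev T) p)) u"
  using assms(2)
proof (induction p arbitrary: u)
  case (Cons a p)
  then have "walk T (terminus T a) [arev T a] u"
    by (auto simp: wf_graphD[OF assms(1)])
  with Cons show ?case by (auto simp: walk_append[OF assms(1)])
qed auto

text \<open>Absence of backtracking. In a tree the reduced walks are the geodesics, so the reduced
  walk to a fixed root serves as an address of a vertex.\<close>

definition reduced :: "('v, 'a) graph \<Rightarrow> 'a list \<Rightarrow> bool" where
  "reduced T = successively (\<lambda>a b. b \<noteq> arev T a)"

lemma reduced_simps [simp]: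
  "reduced T []"
  "reduced T (a # p) \<longleftrightarrow> reduced T p \<and> (p \<noteq> [] \<longrightarrow> hd p \<noteq> arev T a)"
  by (auto simp: reduced_def successively_Cons)

lemma reduced_append:
  "reduced T (p @ q) \<longleftrightarrow>
     reduced T p \<and> reduced T q \<and> (p \<noteq> [] \<longrightarrow> q \<noteq> [] \<longrightarrow> hd q \<noteq> arev T (last p))"
  by (auto simp: reduced_def successively_append_iff)

text \<open>Membership of the arcs is required because \<open>arev\<close> is known to be an
  involution only on \<open>arcs T\<close>.\<close>

lemma reduced_reverse:
  assumes "wf_graph T" "set p \<subseteq> arcs T" "reduced T p"
  shows "reduced T (rev (map (arev T) p))"
  using assms(2,3)
proof (induction p)
  case (Cons a p)
  then show ?case
    by (cases p) (auto simp: reduced_append last_rev hd_map wf_graphD[OF assms(1)])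
qed auto

text \<open>Prepending an arc to a reduced walk either keeps it reduced or cancels against its first
  arc, and in that case the tail already joins the right vertices.\<close>

lemma reduced_walk_exists:
  assumes "wf_graph T" "walk T u p v"
  shows "\<exists>q. walk T u q v \<and> reduced T q"
  using assms(2)
proof (induction p arbitrary: u)
  case Nil
  then have "walk T u [] v \<and> reduced T []" by auto
  then show ?case by blast
next
  case (Cons a p)
  then obtain q where q: "walk T (terminus T a) q v" "reduced T q" by auto
  show ?case
  proof (cases "q \<noteq> [] \<and> hd q = arev T a")
    case True
    then obtain q' where "q = arev T a # q'" by (cases q) auto
    with q Cons.prems show ?thesis by (auto simp: wf_graphD[OF assms(1)])
  next
    case False
    with q Cons.prems have "walk T u (a # q) v \<and> reduced T (a # q)" by auto
    then show ?thesis by blast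
  qed
qed

lemma is_treeD:
  assumes "is_tree T"
  shows "simple_graph T" "wf_graph T" "connected_graph T" "verts T \<noteq> {}"
  using assms unfolding is_tree_def simple_graph_def by blast+

text \<open>A shortest nonempty reduced closed walk repeats no vertex, so it would be a cycle.\<close>

lemma tree_closed_reduced_walk:
  assumes T: "is_tree T" and p: "walk T v p v" "reduced T p"
  shows "p = []"
  using p
proof (induction "length p" arbitrary: p v rule: less_induct)
  case less
  note wf = is_treeD(2)[OF T] and simple = is_treeD(1)[OF T]
  \<comment> \<open>\<open>is_cycle\<close> only speaks of lengths at least 3. A closed walk of
    length 1 would be a loop, and in a simple graph one of length 2 goes back along the same edge;
    both are excluded separately.\<close>
  consider "p = []" | a where "p = [a]" | a b where "p = [a, b]" | "length p \<ge> 3"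
  proof (cases "length p \<ge> 3")
    case False
    then have "length p = 0 \<or> length p = 1 \<or> length p = 2" by linarith
    then show ?thesis using that(1-3) by (auto simp: length_Suc_conv numeral_2_eq_2)
  qed blast
  then show ?case
  proof cases
    case 2
    moreover have "orig T a \<noteq> terminus T a" if "a \<in> arcs T"
      using simple that unfolding simple_graph_def by blast
    ultimately show ?thesis using less.prems by auto
  next
    case 3
    with less.prems have "b = arev T a"
      by (intro simple_graph_arc_eqI[OF simple]) (auto simp: wf_graphD[OF wf])
    with 3 less.prems show ?thesis by auto
  next
    case 4
    have "\<not> is_cycle T p" using T by (auto simp: is_tree_def)
    with 4 less.prems have "\<not> distinct (map (orig T) p)" by (auto simp: is_cycle_def)
    then obtain xs y ys zs where "map (orig T) p = xs @ [y] @ ys @ [y] @ zs"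
      using not_distinct_decomp by blast
    \<comment> \<open>A repeated origin \<open>y\<close> cuts out the closed infix
      \<open>a # p2\<close>. It inherits reducedness and is shorter, since \<open>b # p3\<close> is
      cut off, so the induction hypothesis makes it empty, which is absurd.\<close>
    then obtain p1 a p2 b p3 where p: "p = p1 @ (a # p2) @ b # p3" "orig T a = y" "orig T b = y"
      by (auto simp: map_eq_append_conv map_eq_Cons_conv append_eq_map_conv Cons_eq_map_conv)
    then have "walk T y (a # p2) y" "reduced T (a # p2)"
      using less.prems unfolding p(1) by (auto simp: walk_append[OF wf] reduced_append)
    then have "a # p2 = []" using less.hyps[of "a # p2"] p(1) by simp
    then show ?thesis by simp
  qed auto
qed

text \<open>Common first arcs are stripped. Once the first arcs differ, the reverse of one walk
  followed by the other is closed and has no backtracking at the junction, so it would have to be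
  empty.\<close>

lemma tree_reduced_walk_unique:
  assumes T: "is_tree T"
    and "walk T u p v" "reduced T p" "walk T u q v" "reduced T q"
  shows "p = q"
  using assms(2-)
proof (induction p arbitrary: u q)
  case Nil
  then show ?case using tree_closed_reduced_walk[OF T, of u q] by auto
next
  case (Cons a p)
  note wf = is_treeD(2)[OF T]
  show ?case
  proof (cases q)
    case Nil
    then show ?thesis using Cons.prems tree_closed_reduced_walk[OF T, of u "a # p"] by auto
  next
    case q: (Cons b q')
    show ?thesis
    proof (cases "a = b")
      case True
      then show ?thesis using Cons.prems Cons.IH[of "terminus T a" q'] q by auto
    next
      case False
      define w where "w = rev (map (arev T) q) @ a # p"
      have "walk T v w v"
        unfolding w_def walk_append[OF wf]
        using walk_reverse[OF wf Cons.prems(3)] Cons.prems(1) by blast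
      moreover have "reduced T w"
        using reduced_reverse[OF wf walk_arcs[OF Cons.prems(3)] Cons.prems(4)] Cons.prems q False
        by (auto simp: w_def reduced_append last_rev hd_map wf_graphD[OF wf])
      ultimately have "w = []" by (rule tree_closed_reduced_walk[OF T])
      then show ?thesis by (simp add: w_def)
    qed
  qed
qed

text \<open>
  Every arc is traversed away from the root in exactly one direction, so a choice made
  arc by arc outwards from the root is consistent.
\<close>

lemma tree_recursion:
  assumes T: "is_tree T" and r: "r \<in> verts T" and s0: "Inv r s0"
    and step: "\<And>a s. a \<in> arcs T \<Longrightarrow> Inv (orig T a) s \<Longrightarrow> \<exists>s'. Inv (terminus T a) s' \<and> R a s s'"
  obtains st where "\<And>v. v \<in> verts T \<Longrightarrow> Inv v (st v)"
    and "\<And>a. a \<in> arcs T \<Longrightarrow>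
      R a (st (orig T a)) (st (terminus T a)) \<or> R (arev T a) (st (terminus T a)) (st (orig T a))"
proof -
  note wf = is_treeD(2)[OF T]
  have "\<forall>a s. \<exists>s'. a \<in> arcs T \<longrightarrow> Inv (orig T a) s \<longrightarrow> Inv (terminus T a) s' \<and> R a s s'"
    using step by blast
  then obtain f where f: "\<And>a s. a \<in> arcs T \<Longrightarrow> Inv (orig T a) s \<Longrightarrow>
      Inv (terminus T a) (f a s) \<and> R a s (f a s)"
    by metis
  \<comment> \<open>The geodesic from \<open>v\<close> to the root, which is unique.\<close>
  define P where "P v = (THE p. walk T v p r \<and> reduced T p)" for v
  have P_eqI: "P v = p" if "walk T v p r" "reduced T p" for v p
    unfolding P_def using that tree_reduced_walk_unique[OF T] by blast
  have P: "walk T v (P v) r \<and> reduced T (P v)" if v: "v \<in> verts T" for v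
  proof -
    obtain p where "walk T v p r"
      using is_treeD(3)[OF T] v r by (auto simp: connected_graph_def)
    then obtain q where "walk T v q r" "reduced T q" using reduced_walk_exists[OF wf] by blast
    with P_eqI show ?thesis by metis
  qed
  \<comment> \<open>The walk leads to the root but states spread out from it. So
    \<open>foldr\<close> starts with the last arc, the one that enters the root, and each arc is
    used in reverse.\<close>
  define F where "F p = foldr (\<lambda>a. f (arev T a)) p s0" for p
  have F: "Inv v (F p)" if "walk T v p r" for v p
    using that
  proof (induction p arbitrary: v)
    case Nil
    then show ?case using s0 by (simp add: F_def)
  next
    case (Cons a p)
    then show ?case
      using f[of "arev T a" "F p"] by (auto simp: F_def wf_graphD[OF wf])
  qed
  have along: "R a (F (P (orig T a))) (F (P (terminus T a)))"
    if a: "a \<in> arcs T" and eq: "P (terminus T a) = arev T a # P (orig T a)" for a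
  proof -
    have "Inv (orig T a) (F (P (orig T a)))" using F P a wf_graphD[OF wf] by blast
    with f[OF a this] show ?thesis by (simp add: eq F_def wf_graphD(4)[OF wf a])
  qed
  \<comment> \<open>Prepending \<open>a\<close> to the geodesic from its terminus either stays
    reduced, and is then the geodesic from its origin by uniqueness, or cancels against the first
    arc.\<close>
  have P_step: "P (orig T a) = a # P (terminus T a) \<or> P (terminus T a) = arev T a # P (orig T a)"
    if a: "a \<in> arcs T" for a
  proof (cases "P (terminus T a) \<noteq> [] \<and> hd (P (terminus T a)) = arev T a")
    case True
    then obtain p where p: "P (terminus T a) = arev T a # p" by (cases "P (terminus T a)") auto
    with P[of "terminus T a"] a have "P (orig T a) = p"
      by (intro P_eqI) (auto simp: wf_graphD[OF wf])
    with p show ?thesis by simp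
  next
    case False
    with P[of "terminus T a"] a have "P (orig T a) = a # P (terminus T a)"
      by (intro P_eqI) (auto simp: wf_graphD[OF wf])
    then show ?thesis by simp
  qed
  have "R a (F (P (orig T a))) (F (P (terminus T a))) \<or>
      R (arev T a) (F (P (terminus T a))) (F (P (orig T a)))" if a: "a \<in> arcs T" for a
    using P_step[OF a]
  proof
    assume "P (orig T a) = a # P (terminus T a)"
    then show ?thesis using along[of "arev T a"] by (simp add: wf_graphD[OF wf a])
  qed (use along[OF a] in blast)
  then show ?thesis using that[of "\<lambda>v. F (P v)"] F P by blast
qed

text \<open>Local injectivity keeps walks reduced, so a reduced walk cannot become closed.\<close>

lemma graph_iso_of_locally_bijective:
  assumes S: "wf_graph S" "connected_graph S" "verts S \<noteq> {}" and T: "is_tree T"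
    and hom: "graph_hom S T f h"
    and loc: "\<And>v. v \<in> verts S \<Longrightarrow> bij_betw h (out_arcs S v) (out_arcs T (f v))"
  shows "graph_iso S T f h"
proof -
  have f: "f v \<in> verts T" if "v \<in> verts S" for v
    using hom that by (auto simp: graph_hom_def)
  have h: "h a \<in> arcs T" "orig T (h a) = f (orig S a)" "arev T (h a) = h (arev S a)"
      "terminus T (h a) = f (terminus S a)" if "a \<in> arcs S" for a
    using hom that by (auto simp: graph_hom_def terminus_def wf_graphD(3)[OF S(1)])
  have local_inj: "a = b" if "a \<in> arcs S" "b \<in> arcs S" "orig S a = orig S b" "h a = h b" for a b
    using bij_betw_imp_inj_on[OF loc[of "orig S a"]] that
    by (auto simp: inj_on_def out_arcs_def wf_graphD[OF S(1)])
  have walk: "walk T (f u) (map h p) (f v)" if "walk S u p v" for u p v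
    using that by (induction p arbitrary: u) (auto simp: f h)
  have red: "reduced T (map h p)" if "walk S u p v" "reduced S p" for u p v
    using that
  proof (induction p arbitrary: u)
    case (Cons a p)
    \<comment> \<open>Backtracking in the image means \<open>h b = h (arev S a)\<close>. Both arcs
      start at the terminus of \<open>a\<close>, so local injectivity puts the backtracking already
      into the walk in \<open>S\<close>.\<close>
    have "hd (map h p) \<noteq> arev T (h a)" if ne: "p \<noteq> []"
    proof -
      obtain b q where p: "p = b # q" using ne by (meson neq_Nil_conv)
      then show ?thesis
        using Cons.prems local_inj[of b "arev S a"] by (auto simp: h wf_graphD[OF S(1)])
    qed
    with Cons show ?case by auto
  qed auto
  have inj: "u = v" if uv: "u \<in> verts S" "v \<in> verts S" "f u = f v" for u v
  proof -
    obtain p where "walk S u p v" using S(2) uv by (auto simp: connected_graph_def)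
    then obtain q where q: "walk S u q v" "reduced S q"
      using reduced_walk_exists[OF S(1)] by blast
    have "map h q = []"
      using walk[OF q(1)] red[OF q] uv(3) tree_closed_reduced_walk[OF T] by metis
    with q show ?thesis by simp
  qed
  \<comment> \<open>Path lifting: local surjectivity lifts a walk arc by arc. With connectedness of
    \<open>T\<close> this gives surjectivity on vertices.\<close>
  have ends: "w \<in> f ` verts S" if "walk T (f u) p w" "u \<in> verts S" for u p w
    using that
  proof (induction p arbitrary: u)
    case (Cons b p)
    then have "b \<in> h ` out_arcs S u"
      using loc[of u] by (auto simp: bij_betw_def out_arcs_def)
    then obtain a where a: "a \<in> arcs S" "b = h a" by (auto simp: out_arcs_def)
    then show ?case
      using Cons.prems Cons.IH[of "terminus S a"] by (auto simp: h wf_graphD[OF S(1)])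
  qed auto
  have surj: "f ` verts S = verts T"
  proof
    obtain u where u: "u \<in> verts S" using S(3) by blast
    show "verts T \<subseteq> f ` verts S"
    proof
      fix w assume w: "w \<in> verts T"
      then obtain p where "walk T (f u) p w"
        using is_treeD(3)[OF T] f[OF u] by (auto simp: connected_graph_def)
      with u show "w \<in> f ` verts S" using ends by blast
    qed
  qed (use f in auto)
  have "arcs T \<subseteq> h ` arcs S"
  proof
    fix b assume b: "b \<in> arcs T"
    then have "orig T b \<in> f ` verts S" using surj is_treeD(2)[OF T] by (auto simp: wf_graphD)
    then obtain u where "u \<in> verts S" "orig T b = f u" by blast
    with b loc[of u] have "b \<in> h ` out_arcs S u" by (auto simp: bij_betw_def out_arcs_def)
    then show "b \<in> h ` arcs S" by (auto simp: out_arcs_def)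
  qed
  moreover have "inj_on h (arcs S)"
    using inj local_inj by (intro inj_onI) (metis h(2) wf_graphD(1)[OF S(1)])
  ultimately show ?thesis
    using hom inj surj h(1) by (auto simp: graph_iso_def bij_betw_def inj_on_def)
qed

section \<open>Uniqueness of trees over a local action diagram\<close>

lemma local_action_diagramD:
  assumes "local_action_diagram \<Delta>"
  shows "wf_graph (base \<Delta>)"
    "a \<in> arcs (base \<Delta>) \<Longrightarrow> b \<in> arcs (base \<Delta>) \<Longrightarrow> x \<in> colours \<Delta> a \<Longrightarrow> x \<in> colours \<Delta> b \<Longrightarrow> a = b"
    "v \<in> verts (base \<Delta>) \<Longrightarrow> subgroup (local_group \<Delta> v) (BijGroup (vertex_colours \<Delta> v))"
    "v \<in> verts (base \<Delta>) \<Longrightarrow> a \<in> out_arcs (base \<Delta>) v \<Longrightarrow>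
      \<exists>z\<in>vertex_colours \<Delta> v. colours \<Delta> a = {g z |g. g \<in> local_group \<Delta> v}"
proof -
  note \<Delta> = assms[unfolded local_action_diagram_def]
  show "wf_graph (base \<Delta>)"
    "v \<in> verts (base \<Delta>) \<Longrightarrow> subgroup (local_group \<Delta> v) (BijGroup (vertex_colours \<Delta> v))"
    "a \<in> arcs (base \<Delta>) \<Longrightarrow> b \<in> arcs (base \<Delta>) \<Longrightarrow> x \<in> colours \<Delta> a \<Longrightarrow> x \<in> colours \<Delta> b \<Longrightarrow> a = b"
    using \<Delta> by blast+
  assume "v \<in> verts (base \<Delta>)" "a \<in> out_arcs (base \<Delta>) v"
  then have "colours \<Delta> a \<in> orbits (perm_group (vertex_colours \<Delta> v) (local_group \<Delta> v)) (vertex_colours \<Delta> v) (\<lambda>g. g)"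
    using \<Delta> by blast
  then show "\<exists>z\<in>vertex_colours \<Delta> v. colours \<Delta> a = {g z |g. g \<in> local_group \<Delta> v}"
    by (auto simp: orbits_def orbit_def)
qed

lemma delta_treeD:
  assumes "delta_tree \<Delta> T \<L> \<pi>\<^sub>V \<pi>\<^sub>A"
  shows "is_tree T" "graph_hom T (base \<Delta>) \<pi>\<^sub>V \<pi>\<^sub>A"
    "v \<in> verts T \<Longrightarrow> \<pi>\<^sub>V v \<in> verts (base \<Delta>)"
    "b \<in> arcs T \<Longrightarrow> \<pi>\<^sub>A b \<in> out_arcs (base \<Delta>) (\<pi>\<^sub>V (orig T b))"
    "b \<in> arcs T \<Longrightarrow> \<pi>\<^sub>A (arev T b) = arev (base \<Delta>) (\<pi>\<^sub>A b)"
    "b \<in> arcs T \<Longrightarrow> \<pi>\<^sub>V (terminus T b) = terminus (base \<Delta>) (\<pi>\<^sub>A b)"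
proof -
  show T: "is_tree T" and hom: "graph_hom T (base \<Delta>) \<pi>\<^sub>V \<pi>\<^sub>A"
    using assms unfolding delta_tree_def by blast+
  note wf = is_treeD(2)[OF T]
  show "v \<in> verts T \<Longrightarrow> \<pi>\<^sub>V v \<in> verts (base \<Delta>)"
    "b \<in> arcs T \<Longrightarrow> \<pi>\<^sub>A b \<in> out_arcs (base \<Delta>) (\<pi>\<^sub>V (orig T b))"
    "b \<in> arcs T \<Longrightarrow> \<pi>\<^sub>A (arev T b) = arev (base \<Delta>) (\<pi>\<^sub>A b)"
    "b \<in> arcs T \<Longrightarrow> \<pi>\<^sub>V (terminus T b) = terminus (base \<Delta>) (\<pi>\<^sub>A b)"
    using hom by (auto simp: graph_hom_def out_arcs_def terminus_def wf_graphD(1,3)[OF wf])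
qed

lemma delta_tree_surj:
  assumes "delta_tree \<Delta> T \<L> \<pi>\<^sub>V \<pi>\<^sub>A"
  shows "\<pi>\<^sub>V ` verts T = verts (base \<Delta>)"
  using assms unfolding delta_tree_def by blast

lemma delta_tree_colour_bij:
  assumes "delta_tree \<Delta> T \<L> \<pi>\<^sub>V \<pi>\<^sub>A" "v \<in> verts T" "a \<in> out_arcs (base \<Delta>) (\<pi>\<^sub>V v)"
  shows "bij_betw \<L> {b \<in> out_arcs T v. \<pi>\<^sub>A b = a} (colours \<Delta> a)"
  using assms unfolding delta_tree_def by blast

lemma delta_tree_label:
  assumes D: "delta_tree \<Delta> T \<L> \<pi>\<^sub>V \<pi>\<^sub>A" and b: "b \<in> arcs T"
  shows "\<L> b \<in> colours \<Delta> (\<pi>\<^sub>A b)"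
proof -
  have "orig T b \<in> verts T" using is_treeD(2)[OF delta_treeD(1)[OF D]] b by (rule wf_graphD)
  then have "bij_betw \<L> {c \<in> out_arcs T (orig T b). \<pi>\<^sub>A c = \<pi>\<^sub>A b} (colours \<Delta> (\<pi>\<^sub>A b))"
    using delta_tree_colour_bij[OF D _ delta_treeD(4)[OF D b]] by blast
  then show ?thesis using b by (auto simp: bij_betw_def out_arcs_def)
qed

text \<open>The bijections for single colour sets glue together: the fibres of
  \<open>\<pi>\<^sub>A\<close> partition the arcs at \<open>v\<close>, and disjointness of the
  colour sets puts arcs with equal labels into one fibre.\<close>

lemma delta_tree_label_bij:
  assumes \<Delta>: "local_action_diagram \<Delta>" and D: "delta_tree \<Delta> T \<L> \<pi>\<^sub>V \<pi>\<^sub>A" and v: "v \<in> verts T"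
  shows "bij_betw \<L> (out_arcs T v) (vertex_colours \<Delta> (\<pi>\<^sub>V v))"
proof -
  let ?B = "\<lambda>a. {b \<in> out_arcs T v. \<pi>\<^sub>A b = a}"
  have bij: "bij_betw \<L> (?B a) (colours \<Delta> a)" if "a \<in> out_arcs (base \<Delta>) (\<pi>\<^sub>V v)" for a
    using delta_tree_colour_bij[OF D v that] .
  have "out_arcs T v = (\<Union>a\<in>out_arcs (base \<Delta>) (\<pi>\<^sub>V v). ?B a)"
    using delta_treeD(4)[OF D] by (auto simp: out_arcs_def)
  then have "\<L> ` out_arcs T v = (\<Union>a\<in>out_arcs (base \<Delta>) (\<pi>\<^sub>V v). \<L> ` ?B a)" by blast
  then have "\<L> ` out_arcs T v = vertex_colours \<Delta> (\<pi>\<^sub>V v)"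
    using bij by (simp add: bij_betw_def vertex_colours_def)
  moreover have "inj_on \<L> (out_arcs T v)"
  proof (rule inj_onI)
    fix b c assume b: "b \<in> out_arcs T v" and c: "c \<in> out_arcs T v" and bc: "\<L> b = \<L> c"
    have "b \<in> arcs T" "c \<in> arcs T" using b c by (auto simp: out_arcs_def)
    then have "\<pi>\<^sub>A b = \<pi>\<^sub>A c"
      using delta_tree_label[OF D, of b] delta_tree_label[OF D, of c] delta_treeD(4)[OF D] bc
      by (intro local_action_diagramD(2)[OF \<Delta>]) (auto simp: out_arcs_def)
    moreover have "\<pi>\<^sub>A b \<in> out_arcs (base \<Delta>) (\<pi>\<^sub>V v)"
      using delta_treeD(4)[OF D] b by (auto simp: out_arcs_def)
    ultimately show "b = c"
      using bij_betw_imp_inj_on[OF bij] b c bc by (auto simp: inj_on_def)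
  qed
  ultimately show ?thesis by (simp add: bij_betw_def)
qed

lemma BijGroup_simps [simp]:
  "carrier (BijGroup S) = Bij S"
  "g \<in> Bij S \<Longrightarrow> h \<in> Bij S \<Longrightarrow> g \<otimes>\<^bsub>BijGroup S\<^esub> h = compose S g h"
  "\<one>\<^bsub>BijGroup S\<^esub> = (\<lambda>x\<in>S. x)"
  "g \<in> Bij S \<Longrightarrow> inv\<^bsub>BijGroup S\<^esub> g = (\<lambda>x\<in>S. inv_into S g x)"
  by (simp_all add: inv_BijGroup) (simp_all add: BijGroup_def)

lemma BijD: "g \<in> Bij S \<Longrightarrow> bij_betw g S S" "g \<in> Bij S \<Longrightarrow> g \<in> extensional S"
  by (auto simp: Bij_def)

text \<open>A colour set is the orbit of some \<open>z\<close>. If \<open>x = g z\<close> and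
  \<open>y = h z\<close>, then h g^-1 carries \<open>x\<close> to \<open>y\<close>.\<close>

lemma local_group_transitive:
  assumes \<Delta>: "local_action_diagram \<Delta>" and v: "v \<in> verts (base \<Delta>)"
    and a: "a \<in> out_arcs (base \<Delta>) v" and x: "x \<in> colours \<Delta> a" and y: "y \<in> colours \<Delta> a"
  shows "\<exists>g\<in>local_group \<Delta> v. g x = y"
proof -
  let ?X = "vertex_colours \<Delta> v" and ?G = "local_group \<Delta> v"
  interpret subgroup ?G "BijGroup ?X" using \<Delta> v by (rule local_action_diagramD)
  obtain z where z: "z \<in> ?X" "colours \<Delta> a = {g z |g. g \<in> ?G}"
    using local_action_diagramD(4)[OF \<Delta> v a] by blast
  then obtain g h where g: "g \<in> ?G" "x = g z" and h: "h \<in> ?G" "y = h z" using x y by auto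
  have B: "g \<in> Bij ?X" "h \<in> Bij ?X" using g h subset by auto
  let ?k = "h \<otimes>\<^bsub>BijGroup ?X\<^esub> inv\<^bsub>BijGroup ?X\<^esub> g"
  have k: "?k \<in> ?G" using m_closed[OF h(1) m_inv_closed[OF g(1)]] .
  have inv: "inv\<^bsub>BijGroup ?X\<^esub> g \<in> Bij ?X" using m_inv_closed[OF g(1)] subset by auto
  have "x \<in> ?X" "inv_into ?X g x = z"
    using g(2) z(1) BijD(1)[OF B(1)] by (auto simp: bij_betw_def)
  then have "?k x = y"
    using h(2) unfolding BijGroup_simps(2)[OF B(2) inv] by (simp add: compose_def B(1))
  with k show ?thesis by blast
qed

text \<open>
  The map is built outwards from a root; at each new vertex transitivity of the local
  group on each colour class makes it agree with the reverse of the arc just traversed.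
\<close>

theorem delta_tree_unique:
  assumes \<Delta>: "local_action_diagram \<Delta>"
    and D: "delta_tree \<Delta> T \<L> \<pi>\<^sub>V \<pi>\<^sub>A" and D': "delta_tree \<Delta> T' \<L>' \<pi>\<^sub>V' \<pi>\<^sub>A'"
  obtains \<psi>\<^sub>V \<psi>\<^sub>A \<gamma> where "graph_iso T' T \<psi>\<^sub>V \<psi>\<^sub>A"
    and "\<And>v. v \<in> verts T' \<Longrightarrow> \<pi>\<^sub>V (\<psi>\<^sub>V v) = \<pi>\<^sub>V' v"
    and "\<And>b. b \<in> arcs T' \<Longrightarrow> \<pi>\<^sub>A (\<psi>\<^sub>A b) = \<pi>\<^sub>A' b"
    and "\<And>v. v \<in> verts T' \<Longrightarrow> \<gamma> v \<in> local_group \<Delta> (\<pi>\<^sub>V' v)"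
    and "\<And>b. b \<in> arcs T' \<Longrightarrow> \<L> (\<psi>\<^sub>A b) = \<gamma> (orig T' b) (\<L>' b)"
proof -
  note T = delta_treeD(1)[OF D] and T' = delta_treeD(1)[OF D']
  note wf = is_treeD(2)[OF T] and wf' = is_treeD(2)[OF T']
  note sub = local_action_diagramD(3)[OF \<Delta>]
  have perm: "bij_betw g (vertex_colours \<Delta> v) (vertex_colours \<Delta> v)"
    if "g \<in> local_group \<Delta> v" "v \<in> verts (base \<Delta>)" for g v
    using subgroup.subset[OF sub] that by (auto intro: BijD)
  \<comment> \<open>Colour sets are orbits: if \<open>x\<close> is the image of \<open>z\<close>
    under \<open>h\<close>, then \<open>g x\<close> is the image of \<open>z\<close> under the
    product of \<open>g\<close> and \<open>h\<close>.\<close>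
  have perm_colour: "g x \<in> colours \<Delta> a"
    if g: "g \<in> local_group \<Delta> v" and v: "v \<in> verts (base \<Delta>)" and a: "a \<in> out_arcs (base \<Delta>) v"
      and x: "x \<in> colours \<Delta> a" for g v a x
  proof -
    let ?X = "vertex_colours \<Delta> v" and ?G = "local_group \<Delta> v"
    obtain z where z: "z \<in> ?X" "colours \<Delta> a = {g z |g. g \<in> ?G}"
      using local_action_diagramD(4)[OF \<Delta> v a] by blast
    then obtain h where h: "h \<in> ?G" "x = h z" using x by auto
    have B: "g \<in> Bij ?X" "h \<in> Bij ?X" using g h(1) subgroup.subset[OF sub[OF v]] by auto
    have "compose ?X g h \<in> ?G" using subgroup.m_closed[OF sub[OF v] g h(1)] B by simp
    then have "compose ?X g h z \<in> colours \<Delta> a" using z(2) by blast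
    then show ?thesis using z(1) h(2) by (simp add: compose_def)
  qed
  obtain r where r: "r \<in> verts T'" using is_treeD(4)[OF T'] by blast
  then obtain r' where r': "r' \<in> verts T" "\<pi>\<^sub>V r' = \<pi>\<^sub>V' r"
    using delta_treeD(3)[OF D'] delta_tree_surj[OF D] by (metis imageE)
  \<comment> \<open>A state \<open>s\<close> at a vertex pairs its image in \<open>T\<close> with a
    permutation of the colours. The image of an arc \<open>c\<close> is the arc at the image vertex
    whose label is the permuted label of \<open>c\<close>.\<close>
  define arc where "arc s c = inv_into (out_arcs T (fst s)) \<L> (snd s (\<L>' c))" for s c
  define Inv where "Inv v s \<longleftrightarrow>
    fst s \<in> verts T \<and> \<pi>\<^sub>V (fst s) = \<pi>\<^sub>V' v \<and> snd s \<in> local_group \<Delta> (\<pi>\<^sub>V' v)" for v s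
  \<comment> \<open>For admissible states at the two ends of \<open>b\<close>, this says that the
    image of the reversed arc is the reverse of the image, expressed by origin and label, which
    together determine an arc of \<open>T\<close>.\<close>
  define R where "R b s s' \<longleftrightarrow>
    fst s' = terminus T (arc s b) \<and> snd s' (\<L>' (arev T' b)) = \<L> (arev T (arc s b))" for b s s'
  have arc: "arc s b \<in> out_arcs T (fst s)" "\<L> (arc s b) = snd s (\<L>' b)" "\<pi>\<^sub>A (arc s b) = \<pi>\<^sub>A' b"
    if b: "b \<in> arcs T'" and s: "Inv (orig T' b) s" for b s
  proof -
    have s': "fst s \<in> verts T" "\<pi>\<^sub>V (fst s) = \<pi>\<^sub>V' (orig T' b)" "snd s \<in> local_group \<Delta> (\<pi>\<^sub>V' (orig T' b))"
      using s by (auto simp: Inv_def)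
    have a: "\<pi>\<^sub>A' b \<in> out_arcs (base \<Delta>) (\<pi>\<^sub>V' (orig T' b))" using delta_treeD(4)[OF D' b] .
    have v: "\<pi>\<^sub>V' (orig T' b) \<in> verts (base \<Delta>)" using delta_treeD(3)[OF D'] wf_graphD[OF wf' b] by blast
    have x: "snd s (\<L>' b) \<in> colours \<Delta> (\<pi>\<^sub>A' b)"
      using perm_colour[OF s'(3) v a] delta_tree_label[OF D' b] by blast
    have bij: "bij_betw \<L> (out_arcs T (fst s)) (vertex_colours \<Delta> (\<pi>\<^sub>V' (orig T' b)))"
      using delta_tree_label_bij[OF \<Delta> D s'(1)] s'(2) by simp
    have "snd s (\<L>' b) \<in> \<L> ` out_arcs T (fst s)"
      using bij x a by (auto simp: bij_betw_def vertex_colours_def)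
    then show 1: "arc s b \<in> out_arcs T (fst s)" and 2: "\<L> (arc s b) = snd s (\<L>' b)"
      unfolding arc_def by (auto intro: inv_into_into f_inv_into_f)
    then have c: "arc s b \<in> arcs T" by (simp add: out_arcs_def)
    show "\<pi>\<^sub>A (arc s b) = \<pi>\<^sub>A' b"
      using delta_treeD(4)[OF D c] delta_tree_label[OF D c] a x 2
      by (intro local_action_diagramD(2)[OF \<Delta>]) (auto simp: out_arcs_def)
  qed
  \<comment> \<open>At the root any vertex of \<open>T\<close> over the same base vertex will do,
    with the identity permutation.\<close>
  have "Inv r (r', \<lambda>x\<in>vertex_colours \<Delta> (\<pi>\<^sub>V' r). x)"
    using r' subgroup.one_closed[OF sub[OF delta_treeD(3)[OF D' r]]] by (simp add: Inv_def)
  moreover have "\<exists>s'. Inv (terminus T' b) s' \<and> R b s s'"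
    if b: "b \<in> arcs T'" and s: "Inv (orig T' b) s" for b s
  proof -
    let ?c = "arc s b"
    note b' = wf_graphD(3)[OF wf' b]
    have c: "?c \<in> arcs T" using arc(1)[OF b s] by (simp add: out_arcs_def)
    have a: "\<pi>\<^sub>A' (arev T' b) \<in> out_arcs (base \<Delta>) (\<pi>\<^sub>V' (terminus T' b))"
      using delta_treeD(4)[OF D' b'] wf_graphD[OF wf' b] by simp
    have "\<pi>\<^sub>A (arev T ?c) = \<pi>\<^sub>A' (arev T' b)"
      using arc(3)[OF b s] delta_treeD(5)[OF D c] delta_treeD(5)[OF D' b] by simp
    then have y: "\<L> (arev T ?c) \<in> colours \<Delta> (\<pi>\<^sub>A' (arev T' b))"
      using delta_tree_label[OF D wf_graphD(3)[OF wf c]] by simp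
    have v: "\<pi>\<^sub>V' (terminus T' b) \<in> verts (base \<Delta>)"
      using delta_treeD(3)[OF D'] wf_graphD[OF wf' b] by blast
    obtain g where "g \<in> local_group \<Delta> (\<pi>\<^sub>V' (terminus T' b))" "g (\<L>' (arev T' b)) = \<L> (arev T ?c)"
      using local_group_transitive[OF \<Delta> v a delta_tree_label[OF D' b'] y] by blast
    moreover have "\<pi>\<^sub>V (terminus T ?c) = \<pi>\<^sub>V' (terminus T' b)"
      using arc(3)[OF b s] delta_treeD(6)[OF D c] delta_treeD(6)[OF D' b] by simp
    ultimately have "Inv (terminus T' b) (terminus T ?c, g) \<and> R b s (terminus T ?c, g)"
      using wf_graphD[OF wf c] by (simp add: Inv_def R_def)
    then show ?thesis by blast
  qed
  ultimately obtain st where st: "\<And>v. v \<in> verts T' \<Longrightarrow> Inv v (st v)"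
    and Rst: "\<And>b. b \<in> arcs T' \<Longrightarrow>
      R b (st (orig T' b)) (st (terminus T' b)) \<or> R (arev T' b) (st (terminus T' b)) (st (orig T' b))"
    using tree_recursion[OF T' r, of Inv _ R] by blast
  define \<psi>\<^sub>V where "\<psi>\<^sub>V v = fst (st v)" for v
  define \<gamma> where "\<gamma> v = snd (st v)" for v
  define \<psi>\<^sub>A where "\<psi>\<^sub>A b = arc (st (orig T' b)) b" for b
  have \<psi>: "\<psi>\<^sub>V v \<in> verts T" "\<pi>\<^sub>V (\<psi>\<^sub>V v) = \<pi>\<^sub>V' v" "\<gamma> v \<in> local_group \<Delta> (\<pi>\<^sub>V' v)"
    if "v \<in> verts T'" for v
    using st[OF that] by (auto simp: \<psi>\<^sub>V_def \<gamma>_def Inv_def)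
  have \<psi>\<^sub>A: "\<psi>\<^sub>A b \<in> out_arcs T (\<psi>\<^sub>V (orig T' b))" "\<L> (\<psi>\<^sub>A b) = \<gamma> (orig T' b) (\<L>' b)" "\<pi>\<^sub>A (\<psi>\<^sub>A b) = \<pi>\<^sub>A' b"
    if b: "b \<in> arcs T'" for b
    using arc[OF b st] wf_graphD[OF wf' b] by (auto simp: \<psi>\<^sub>A_def \<psi>\<^sub>V_def \<gamma>_def)
  have \<psi>\<^sub>A_arcs: "\<psi>\<^sub>A b \<in> arcs T" if "b \<in> arcs T'" for b
    using \<psi>\<^sub>A(1)[OF that] by (simp add: out_arcs_def)
  \<comment> \<open>Both sides start at \<open>\<psi>\<^sub>V (terminus T' b)\<close> and carry the
    same label, and \<open>\<L>\<close> is injective on the arcs at one vertex.\<close>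
  have rev_if: "\<psi>\<^sub>A (arev T' b) = arev T (\<psi>\<^sub>A b)"
    if b: "b \<in> arcs T'" and Rb: "R b (st (orig T' b)) (st (terminus T' b))" for b
  proof -
    have o: "\<psi>\<^sub>V (terminus T' b) = terminus T (\<psi>\<^sub>A b)"
      and l: "\<gamma> (terminus T' b) (\<L>' (arev T' b)) = \<L> (arev T (\<psi>\<^sub>A b))"
      using Rb by (auto simp: R_def \<psi>\<^sub>V_def \<psi>\<^sub>A_def \<gamma>_def)
    have "arev T (\<psi>\<^sub>A b) \<in> out_arcs T (\<psi>\<^sub>V (terminus T' b))"
      using wf_graphD[OF wf \<psi>\<^sub>A_arcs[OF b]] o by (simp add: out_arcs_def)
    moreover have "\<psi>\<^sub>A (arev T' b) \<in> out_arcs T (\<psi>\<^sub>V (terminus T' b))"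
      using \<psi>\<^sub>A(1)[OF wf_graphD(3)[OF wf' b]] wf_graphD[OF wf' b] by simp
    moreover have "\<L> (\<psi>\<^sub>A (arev T' b)) = \<L> (arev T (\<psi>\<^sub>A b))"
      using \<psi>\<^sub>A(2)[OF wf_graphD(3)[OF wf' b]] l wf_graphD[OF wf' b] by simp
    moreover have "inj_on \<L> (out_arcs T (\<psi>\<^sub>V (terminus T' b)))"
      using delta_tree_label_bij[OF \<Delta> D \<psi>(1)] wf_graphD[OF wf' b] by (auto simp: bij_betw_def)
    ultimately show ?thesis by (auto dest: inj_onD)
  qed
  have rev: "arev T (\<psi>\<^sub>A b) = \<psi>\<^sub>A (arev T' b)" if b: "b \<in> arcs T'" for b
    using Rst[OF b]
  proof
    assume "R (arev T' b) (st (terminus T' b)) (st (orig T' b))"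
    then have "\<psi>\<^sub>A b = arev T (\<psi>\<^sub>A (arev T' b))"
      using rev_if[of "arev T' b"] wf_graphD[OF wf' b] by simp
    then show ?thesis
      using wf_graphD(4)[OF wf \<psi>\<^sub>A_arcs[OF wf_graphD(3)[OF wf' b]]] by simp
  qed (use rev_if[OF b] in simp)
  have hom: "graph_hom T' T \<psi>\<^sub>V \<psi>\<^sub>A"
    using \<psi>(1) \<psi>\<^sub>A(1) rev by (auto simp: graph_hom_def out_arcs_def)
  have "bij_betw \<psi>\<^sub>A (out_arcs T' v) (out_arcs T (\<psi>\<^sub>V v))" if v: "v \<in> verts T'" for v
  proof -
    \<comment> \<open>On the arcs at \<open>v\<close> the map \<open>\<psi>\<^sub>A\<close> is
      \<open>\<L>'\<close>, then \<open>\<gamma> v\<close>, then the inverse of \<open>\<L>\<close>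
      at the image vertex: a composite of bijections.\<close>
    have "bij_betw (\<gamma> v \<circ> \<L>') (out_arcs T' v) (vertex_colours \<Delta> (\<pi>\<^sub>V' v))"
      using delta_tree_label_bij[OF \<Delta> D' v] perm[OF \<psi>(3)[OF v] delta_treeD(3)[OF D' v]]
      by (rule bij_betw_trans)
    moreover have "bij_betw (inv_into (out_arcs T (\<psi>\<^sub>V v)) \<L>) (vertex_colours \<Delta> (\<pi>\<^sub>V' v)) (out_arcs T (\<psi>\<^sub>V v))"
      using delta_tree_label_bij[OF \<Delta> D \<psi>(1)[OF v]] \<psi>(2)[OF v] by (auto intro: bij_betw_inv_into)
    ultimately have "bij_betw (inv_into (out_arcs T (\<psi>\<^sub>V v)) \<L> \<circ> (\<gamma> v \<circ> \<L>')) (out_arcs T' v) (out_arcs T (\<psi>\<^sub>V v))"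
      by (rule bij_betw_trans)
    then show ?thesis
      by (rule bij_betw_cong[THEN iffD1, rotated])
        (auto simp: \<psi>\<^sub>A_def arc_def \<psi>\<^sub>V_def \<gamma>_def out_arcs_def)
  qed
  then have "graph_iso T' T \<psi>\<^sub>V \<psi>\<^sub>A"
    using graph_iso_of_locally_bijective[OF wf' is_treeD(3,4)[OF T'] T hom] by blast
  then show ?thesis using that[of \<psi>\<^sub>V \<psi>\<^sub>A \<gamma>] \<psi> \<psi>\<^sub>A by blast
qed

section \<open>Automorphisms and conjugation\<close>

lemma graph_homD:
  assumes "graph_hom A B f h"
  shows "v \<in> verts A \<Longrightarrow> f v \<in> verts B"
    "a \<in> arcs A \<Longrightarrow> h a \<in> arcs B"
    "a \<in> arcs A \<Longrightarrow> orig B (h a) = f (orig A a)"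
    "a \<in> arcs A \<Longrightarrow> arev B (h a) = h (arev A a)"
    "wf_graph A \<Longrightarrow> a \<in> arcs A \<Longrightarrow> terminus B (h a) = f (terminus A a)"
proof -
  show "v \<in> verts A \<Longrightarrow> f v \<in> verts B"
    "a \<in> arcs A \<Longrightarrow> h a \<in> arcs B"
    "a \<in> arcs A \<Longrightarrow> orig B (h a) = f (orig A a)"
    "a \<in> arcs A \<Longrightarrow> arev B (h a) = h (arev A a)"
    using assms by (auto simp: graph_hom_def)
  show "wf_graph A \<Longrightarrow> a \<in> arcs A \<Longrightarrow> terminus B (h a) = f (terminus A a)"
    using assms by (auto simp: graph_hom_def terminus_def wf_graphD(3))
qed

lemma graph_hom_comp:
  assumes "graph_hom A B f h" "graph_hom B C f' h'"
  shows "graph_hom A C (\<lambda>v. f' (f v)) (\<lambda>a. h' (h a))"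
  unfolding graph_hom_def
  using graph_homD[OF assms(1)] graph_homD[OF assms(2)] by auto

lemma graph_isoD:
  assumes "graph_iso A B f h"
  shows "graph_hom A B f h" "bij_betw f (verts A) (verts B)" "bij_betw h (arcs A) (arcs B)"
  using assms by (auto simp: graph_iso_def)

lemma graph_autD:
  assumes "simple_graph T" "g \<in> graph_aut T"
  shows "g \<in> Bij (verts T)" "graph_iso T T g (arc_map T g)"
proof -
  show "g \<in> Bij (verts T)" using assms(2) by (simp add: graph_aut_def)
  show "graph_iso T T g (arc_map T g)"
    using theI'[OF arc_map_unique[OF assms]] by (simp add: arc_map_def)
qed

text \<open>Endpoints determine an arc of a simple graph. So \<open>arc_map\<close>, although
  defined by a description operator, can be computed from the action on vertices alone.\<close>

lemma arc_map_eqI: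
  assumes T: "simple_graph T" and g: "g \<in> graph_aut T" and a: "a \<in> arcs T" "b \<in> arcs T"
    and ends: "orig T b = g (orig T a)" "terminus T b = g (terminus T a)"
  shows "arc_map T g a = b"
proof -
  have wf: "wf_graph T" using T unfolding simple_graph_def by blast
  note hom = graph_homD[OF graph_isoD(1)[OF graph_autD(2)[OF T g]]]
  show ?thesis
    using hom(2,3)[OF a(1)] hom(5)[OF wf a(1)] a ends
    by (intro simple_graph_arc_eqI[OF T]) auto
qed

section \<open>Conjugation of permutations by a bijection\<close>

lemma conj_perm_apply:
  assumes "bij_betw \<phi> X Y" "x \<in> X"
  shows "conj_perm \<phi> X Y g (\<phi> x) = \<phi> (g x)"
  using assms by (auto simp: conj_perm_def bij_betw_def)

lemma conj_perm_Bij: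
  assumes \<phi>: "bij_betw \<phi> X Y" and g: "g \<in> Bij X"
  shows "conj_perm \<phi> X Y g \<in> Bij Y"
proof -
  have "bij_betw (\<phi> \<circ> (g \<circ> inv_into X \<phi>)) Y Y"
    using bij_betw_trans[OF bij_betw_trans[OF bij_betw_inv_into[OF \<phi>] BijD(1)[OF g]] \<phi>] .
  then have "bij_betw (conj_perm \<phi> X Y g) Y Y"
    by (rule bij_betw_cong[THEN iffD1, rotated]) (simp add: conj_perm_def)
  then show ?thesis by (simp add: Bij_def conj_perm_def)
qed

text \<open>Provides that the conjugate of a permutation group is again a subgroup of the symmetric
  group.\<close>

lemma conj_perm_hom:
  assumes \<phi>: "bij_betw \<phi> X Y"
  shows "group_hom (BijGroup X) (BijGroup Y) (conj_perm \<phi> X Y)"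
proof -
  have "conj_perm \<phi> X Y (compose X g h) = compose Y (conj_perm \<phi> X Y g) (conj_perm \<phi> X Y h)"
    if h: "h \<in> Bij X" for g h
  proof (rule extensionalityI[where A = Y])
    fix y assume "y \<in> Y"
    then obtain x where x: "x \<in> X" "y = \<phi> x" using \<phi> by (auto simp: bij_betw_def)
    moreover have "h x \<in> X" using BijD(1)[OF h] x by (auto simp: bij_betw_def)
    ultimately show "conj_perm \<phi> X Y (compose X g h) y = compose Y (conj_perm \<phi> X Y g) (conj_perm \<phi> X Y h) y"
      using \<open>y \<in> Y\<close> by (simp add: conj_perm_apply[OF \<phi>] compose_def)
  qed (auto simp: conj_perm_def)
  then have "conj_perm \<phi> X Y \<in> hom (BijGroup X) (BijGroup Y)"
    by (auto simp: hom_def conj_perm_Bij[OF \<phi>])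
  then show ?thesis
    by (simp add: group_hom_def group_hom_axioms_def group_BijGroup)
qed

text \<open>At \<open>\<psi>\<^sub>V u\<close> the local action of the conjugate is the product of
  \<open>\<gamma> (g u)\<close>, the local action \<tau> of \<open>g\<close> at \<open>u\<close>,
  and the inverse of \<open>\<gamma> u\<close>. All three lie in the local group at
  \<open>\<pi>\<^sub>V' u\<close>, because \<open>g\<close> preserves
  \<open>\<pi>\<^sub>V'\<close>.\<close>

theorem conj_perm_universal_group:
  assumes \<Delta>: "local_action_diagram \<Delta>"
    and D: "delta_tree \<Delta> T \<L> \<pi>\<^sub>V \<pi>\<^sub>A" and D': "delta_tree \<Delta> T' \<L>' \<pi>\<^sub>V' \<pi>\<^sub>A'"
    and iso: "graph_iso T' T \<psi>\<^sub>V \<psi>\<^sub>A"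
    and over: "\<And>v. v \<in> verts T' \<Longrightarrow> \<pi>\<^sub>V (\<psi>\<^sub>V v) = \<pi>\<^sub>V' v" "\<And>b. b \<in> arcs T' \<Longrightarrow> \<pi>\<^sub>A (\<psi>\<^sub>A b) = \<pi>\<^sub>A' b"
    and \<gamma>: "\<And>v. v \<in> verts T' \<Longrightarrow> \<gamma> v \<in> local_group \<Delta> (\<pi>\<^sub>V' v)"
    and label: "\<And>b. b \<in> arcs T' \<Longrightarrow> \<L> (\<psi>\<^sub>A b) = \<gamma> (orig T' b) (\<L>' b)"
    and g: "g \<in> universal_group \<Delta> T' \<L>' \<pi>\<^sub>V' \<pi>\<^sub>A'"
  shows "conj_perm \<psi>\<^sub>V (verts T') (verts T) g \<in> universal_group \<Delta> T \<L> \<pi>\<^sub>V \<pi>\<^sub>A"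
proof -
  note T = is_treeD[OF delta_treeD(1)[OF D]] and T' = is_treeD[OF delta_treeD(1)[OF D']]
  note \<psi> = graph_homD[OF graph_isoD(1)[OF iso]]
  let ?k = "conj_perm \<psi>\<^sub>V (verts T') (verts T) g"
  have g_aut: "g \<in> graph_aut T'"
    and g_V: "\<And>v. v \<in> verts T' \<Longrightarrow> \<pi>\<^sub>V' (g v) = \<pi>\<^sub>V' v"
    and g_A: "\<And>b. b \<in> arcs T' \<Longrightarrow> \<pi>\<^sub>A' (arc_map T' g b) = \<pi>\<^sub>A' b"
    and g_loc: "\<And>v. v \<in> verts T' \<Longrightarrow> local_action \<Delta> T' \<L>' \<pi>\<^sub>V' v g \<in> local_group \<Delta> (\<pi>\<^sub>V' v)"
    using g unfolding universal_group_def graph_aut_over_def by blast+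
  note g_Bij = graph_autD(1)[OF T'(1) g_aut] and g_iso = graph_autD(2)[OF T'(1) g_aut]
  note g_hom = graph_homD[OF graph_isoD(1)[OF g_iso]]
  note \<psi>_bij = graph_isoD(2,3)[OF iso]
  have k: "?k (\<psi>\<^sub>V u) = \<psi>\<^sub>V (g u)" if "u \<in> verts T'" for u
    using conj_perm_apply[OF \<psi>_bij(1) that] .
  have lift_vert: "\<exists>u\<in>verts T'. v = \<psi>\<^sub>V u" if "v \<in> verts T" for v
    using \<psi>_bij(1) that by (auto simp: bij_betw_def)
  have lift_arc: "\<exists>c\<in>arcs T'. b = \<psi>\<^sub>A c" if "b \<in> arcs T" for b
    using \<psi>_bij(2) that by (auto simp: bij_betw_def)
  \<comment> \<open>Membership in \<open>graph_aut\<close> asks for some arc map; conjugating that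
    of \<open>g\<close> by \<open>\<psi>\<^sub>A\<close> supplies one.\<close>
  have "graph_iso T T ?k (conj_perm \<psi>\<^sub>A (arcs T') (arcs T) (arc_map T' g))" (is "graph_iso T T _ ?K")
  proof -
    have K: "?K (\<psi>\<^sub>A c) = \<psi>\<^sub>A (arc_map T' g c)" if "c \<in> arcs T'" for c
      using conj_perm_apply[OF \<psi>_bij(2) that] .
    have "bij_betw (\<psi>\<^sub>A \<circ> (arc_map T' g \<circ> inv_into (arcs T') \<psi>\<^sub>A)) (arcs T) (arcs T)"
      using bij_betw_trans[OF bij_betw_trans[OF bij_betw_inv_into[OF \<psi>_bij(2)] graph_isoD(3)[OF g_iso]] \<psi>_bij(2)] .
    then have "bij_betw ?K (arcs T) (arcs T)"
      by (rule bij_betw_cong[THEN iffD1, rotated]) (simp add: conj_perm_def)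
    moreover have "bij_betw ?k (verts T) (verts T)"
      using conj_perm_Bij[OF \<psi>_bij(1) g_Bij] by (rule BijD)
    moreover have "orig T (?K b) = ?k (orig T b) \<and> arev T (?K b) = ?K (arev T b)" if b: "b \<in> arcs T" for b
    proof -
      obtain c where c: "c \<in> arcs T'" "b = \<psi>\<^sub>A c" using lift_arc[OF b] by blast
      then show ?thesis using wf_graphD[OF T'(2) c(1)] by (simp add: K k \<psi> g_hom)
    qed
    ultimately show ?thesis by (auto simp: graph_iso_def graph_hom_def bij_betw_def)
  qed
  then have k_aut: "?k \<in> graph_aut T"
    using conj_perm_Bij[OF \<psi>_bij(1) g_Bij] by (auto simp: graph_aut_def)
  have arc_k: "arc_map T ?k (\<psi>\<^sub>A c) = \<psi>\<^sub>A (arc_map T' g c)" if c: "c \<in> arcs T'" for c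
    using wf_graphD[OF T'(2) c] c T'(2)
    by (intro arc_map_eqI[OF T(1) k_aut]) (simp_all add: k \<psi> g_hom)
  have "\<pi>\<^sub>V (?k v) = \<pi>\<^sub>V v" if "v \<in> verts T" for v
    using lift_vert[OF that] by (auto simp: k over g_V g_hom)
  moreover have "\<pi>\<^sub>A (arc_map T ?k b) = \<pi>\<^sub>A b" if "b \<in> arcs T" for b
    using lift_arc[OF that] by (auto simp: arc_k over g_A g_hom)
  moreover have "local_action \<Delta> T \<L> \<pi>\<^sub>V v ?k \<in> local_group \<Delta> (\<pi>\<^sub>V v)" if v: "v \<in> verts T" for v
  proof -
    obtain u where u: "u \<in> verts T'" "v = \<psi>\<^sub>V u" using lift_vert[OF v] by blast
    define w where "w = \<pi>\<^sub>V' u"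
    have w: "w \<in> verts (base \<Delta>)" "\<pi>\<^sub>V v = w" "\<pi>\<^sub>V' (g u) = w"
      using delta_treeD(3)[OF D' u(1)] over(1)[OF u(1)] g_V[OF u(1)] u(2) by (auto simp: w_def)
    let ?X = "vertex_colours \<Delta> w"
    interpret subgroup "local_group \<Delta> w" "BijGroup ?X"
      using local_action_diagramD(3)[OF \<Delta> w(1)] .
    define \<tau> where "\<tau> = local_action \<Delta> T' \<L>' \<pi>\<^sub>V' u g"
    have \<tau>: "\<tau> \<in> local_group \<Delta> w" using g_loc[OF u(1)] by (simp add: \<tau>_def w_def)
    have \<gamma>u: "\<gamma> u \<in> local_group \<Delta> w" and \<gamma>g: "\<gamma> (g u) \<in> local_group \<Delta> w"
      using \<gamma>[OF u(1)] \<gamma>[OF g_hom(1)[OF u(1)]] w by (auto simp: w_def)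
    have Bij: "\<tau> \<in> Bij ?X" "\<gamma> u \<in> Bij ?X" "\<gamma> (g u) \<in> Bij ?X"
      using \<tau> \<gamma>u \<gamma>g subset by auto
    have inv: "inv\<^bsub>BijGroup ?X\<^esub> (\<gamma> u) = (\<lambda>x\<in>?X. inv_into ?X (\<gamma> u) x)" using Bij(2) by simp
    have inv_mem: "(\<lambda>x\<in>?X. inv_into ?X (\<gamma> u) x) \<in> local_group \<Delta> w"
      using m_inv_closed[OF \<gamma>u] unfolding inv .
    then have inv_Bij: "(\<lambda>x\<in>?X. inv_into ?X (\<gamma> u) x) \<in> Bij ?X" using subset by auto
    let ?m = "compose ?X (\<gamma> (g u)) (compose ?X \<tau> (\<lambda>x\<in>?X. inv_into ?X (\<gamma> u) x))"
    have m: "?m \<in> local_group \<Delta> w"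
      using m_closed[OF \<gamma>g m_closed[OF \<tau> inv_mem]] Bij inv_Bij by (simp add: compose_Bij)
    have bij': "bij_betw \<L>' (out_arcs T' u) ?X"
      using delta_tree_label_bij[OF \<Delta> D' u(1)] by (simp add: w_def)
    have bij: "bij_betw \<L> (out_arcs T v) ?X"
      using delta_tree_label_bij[OF \<Delta> D v] by (simp add: w)
    have "local_action \<Delta> T \<L> \<pi>\<^sub>V v ?k = ?m"
    proof (rule extensionalityI[where A = ?X])
      fix x assume x: "x \<in> ?X"
      \<comment> \<open>With \<open>x\<close> written in this form, \<open>\<psi>\<^sub>A b\<close>
        is the arc at \<open>v\<close> labelled \<open>x\<close>, which evaluates the inverse of the
        labelling.\<close>
      then obtain b where b: "b \<in> out_arcs T' u" "x = \<gamma> u (\<L>' b)"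
        using BijD(1)[OF Bij(2)] bij' by (metis bij_betw_def imageE)
      then have b': "b \<in> arcs T'" "orig T' b = u" by (auto simp: out_arcs_def)
      have Lb: "\<L>' b \<in> ?X" using bij' b(1) by (auto simp: bij_betw_def)
      have "\<L> (\<psi>\<^sub>A b) = x" using label[OF b'(1)] b b' by simp
      moreover have "\<psi>\<^sub>A b \<in> out_arcs T v" using \<psi>(2,3)[OF b'(1)] b' u by (simp add: out_arcs_def)
      ultimately have "inv_into (out_arcs T v) \<L> x = \<psi>\<^sub>A b"
        using bij_betw_inv_into_left[OF bij] by metis
      then have l: "local_action \<Delta> T \<L> \<pi>\<^sub>V v ?k x = \<L> (\<psi>\<^sub>A (arc_map T' g b))"
        using x w by (simp add: local_action_def arc_k[OF b'(1)])
      have "inv_into ?X (\<gamma> u) x = \<L>' b"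
        unfolding b(2) using bij_betw_inv_into_left[OF BijD(1)[OF Bij(2)] Lb] .
      moreover have "\<tau> (\<L>' b) = \<L>' (arc_map T' g b)"
        using Lb bij_betw_inv_into_left[OF bij' b(1)] by (simp add: \<tau>_def local_action_def w_def)
      ultimately have "?m x = \<gamma> (g u) (\<L>' (arc_map T' g b))"
        using x by (simp add: compose_def)
      then show "local_action \<Delta> T \<L> \<pi>\<^sub>V v ?k x = ?m x"
        using l label[OF g_hom(2)[OF b'(1)]] g_hom(3)[OF b'(1)] b'(2) by simp
    qed (auto simp: local_action_def w)
    with m w show ?thesis by simp
  qed
  ultimately show ?thesis using k_aut by (simp add: universal_group_def graph_aut_over_def)
qed

section \<open>Groups acting on a tree\<close>

locale tree_action =
  fixes T :: "('v, 'a) graph" and G :: "('v \<Rightarrow> 'v) set"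
  assumes tree: "is_tree T" and subgroup_G: "subgroup G (BijGroup (verts T))"
    and aut_G: "G \<subseteq> graph_aut T"
begin

lemmas simple = is_treeD(1)[OF tree] and wf = is_treeD(2)[OF tree]

lemma G_Bij: "g \<in> G \<Longrightarrow> g \<in> Bij (verts T)"
  using subgroup.subset[OF subgroup_G] by auto

lemma G_hom:
  assumes "g \<in> G"
  shows "v \<in> verts T \<Longrightarrow> g v \<in> verts T"
    "a \<in> arcs T \<Longrightarrow> arc_map T g a \<in> arcs T"
    "a \<in> arcs T \<Longrightarrow> orig T (arc_map T g a) = g (orig T a)"
    "a \<in> arcs T \<Longrightarrow> arev T (arc_map T g a) = arc_map T g (arev T a)"
    "a \<in> arcs T \<Longrightarrow> terminus T (arc_map T g a) = g (terminus T a)"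
  using graph_homD[OF graph_isoD(1)[OF graph_autD(2)[OF simple]]] aut_G assms wf by blast+

lemma G_compose: "g \<in> G \<Longrightarrow> h \<in> G \<Longrightarrow> compose (verts T) g h \<in> G"
  using subgroup.m_closed[OF subgroup_G, of g h] by (simp add: G_Bij)

lemma G_id: "(\<lambda>x\<in>verts T. x) \<in> G"
  using subgroup.one_closed[OF subgroup_G] by simp

lemma G_inverse:
  assumes g: "g \<in> G"
  obtains g' where "g' \<in> G" "\<And>v. v \<in> verts T \<Longrightarrow> g' (g v) = v"
proof
  show "inv\<^bsub>BijGroup (verts T)\<^esub> g \<in> G" using subgroup.m_inv_closed[OF subgroup_G g] .
  show "(inv\<^bsub>BijGroup (verts T)\<^esub> g) (g v) = v" if "v \<in> verts T" for v
    using that G_hom(1)[OF g that] bij_betw_inv_into_left[OF BijD(1)[OF G_Bij[OF g]]]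
    by (simp add: G_Bij[OF g])
qed

lemma arc_map_compose:
  assumes g: "g \<in> G" and h: "h \<in> G" and a: "a \<in> arcs T"
  shows "arc_map T (compose (verts T) g h) a = arc_map T g (arc_map T h a)"
  using aut_G G_compose[OF g h] a wf_graphD[OF wf a]
  by (intro arc_map_eqI[OF simple]) (auto simp: G_hom[OF g] G_hom[OF h] compose_def)

section \<open>Orbits and the quotient map\<close>

lemma vertex_orbit_eq: "vertex_orbit T G v = (\<lambda>g. g v) ` G"
  by (auto simp: vertex_orbit_def orbit_def)

lemma arc_orbit_eq: "arc_orbit T G a = (\<lambda>g. arc_map T g a) ` G"
  by (auto simp: arc_orbit_def orbit_def)

lemma vertex_orbit_self: "v \<in> verts T \<Longrightarrow> v \<in> vertex_orbit T G v"
  unfolding vertex_orbit_eq by (rule image_eqI[OF _ G_id]) simp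

lemma vertex_orbit_act:
  assumes g: "g \<in> G" and v: "v \<in> verts T"
  shows "vertex_orbit T G (g v) = vertex_orbit T G v"
proof -
  have sub: "vertex_orbit T G (g v) \<subseteq> vertex_orbit T G v" if "g \<in> G" "v \<in> verts T" for g v
  proof
    fix w assume "w \<in> vertex_orbit T G (g v)"
    then obtain h where h: "h \<in> G" "w = h (g v)" by (auto simp: vertex_orbit_eq)
    then have "w = compose (verts T) h g v" using that(2) by (simp add: compose_def)
    then show "w \<in> vertex_orbit T G v" using G_compose[OF h(1) that(1)] by (auto simp: vertex_orbit_eq)
  qed
  \<comment> \<open>The inclusion just proved, applied to \<open>g'\<close> at \<open>g v\<close>,
    is the converse inclusion.\<close>
  obtain g' where "g' \<in> G" "g' (g v) = v" using G_inverse[OF g] v by metis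
  then show ?thesis using sub[OF g v] sub[of g' "g v"] G_hom(1)[OF g v] by auto
qed

lemma arc_orbit_act:
  assumes g: "g \<in> G" and a: "a \<in> arcs T"
  shows "arc_orbit T G (arc_map T g a) = arc_orbit T G a"
proof -
  have sub: "arc_orbit T G (arc_map T g a) \<subseteq> arc_orbit T G a" if "g \<in> G" "a \<in> arcs T" for g a
  proof
    fix b assume "b \<in> arc_orbit T G (arc_map T g a)"
    then obtain h where h: "h \<in> G" "b = arc_map T h (arc_map T g a)" by (auto simp: arc_orbit_eq)
    then have "b = arc_map T (compose (verts T) h g) a" using that by (simp add: arc_map_compose)
    then show "b \<in> arc_orbit T G a" using G_compose[OF h(1) that(1)] by (auto simp: arc_orbit_eq)
  qed
  obtain g' where g': "g' \<in> G" "\<And>v. v \<in> verts T \<Longrightarrow> g' (g v) = v" using G_inverse[OF g] by metis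
  \<comment> \<open>An inverse on vertices is also one on arcs, since both endpoints of
    \<open>a\<close> are restored.\<close>
  have "arc_map T g' (arc_map T g a) = a"
    using aut_G g'(1) a wf_graphD[OF wf a]
    by (intro arc_map_eqI[OF simple]) (auto simp: G_hom[OF g] g'(2))
  then show ?thesis using sub[OF g a] sub[OF g'(1) G_hom(2)[OF g a]] by auto
qed

text \<open>Since \<open>G\<close> commutes with origin and reversal, \<open>orig T\<close> and
  \<open>arev T\<close> map orbits onto orbits, as the set-image definition of the quotient
  requires.\<close>

lemma quotient_hom: "graph_hom T (quotient_graph T G) (vertex_orbit T G) (arc_orbit T G)"
proof -
  have "orig T ` arc_orbit T G a = vertex_orbit T G (orig T a)"
    "arev T ` arc_orbit T G a = arc_orbit T G (arev T a)" if "a \<in> arcs T" for a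
    using that by (auto simp: vertex_orbit_eq arc_orbit_eq image_image G_hom intro!: image_cong)
  then show ?thesis by (auto simp: graph_hom_def quotient_graph_def)
qed

text \<open>For surjectivity, an arc at \<open>g v\<close> has a preimage somewhere in
  \<open>T\<close>, and injectivity of \<open>g\<close> on vertices forces that preimage to start at
  \<open>v\<close>.\<close>

lemma out_arcs_act:
  assumes g: "g \<in> G" and v: "v \<in> verts T"
  shows "bij_betw (arc_map T g) (out_arcs T v) (out_arcs T (g v))"
proof -
  have bij: "bij_betw (arc_map T g) (arcs T) (arcs T)"
    using graph_isoD(3)[OF graph_autD(2)[OF simple]] aut_G g by blast
  have inj: "inj_on g (verts T)" using BijD(1)[OF G_Bij[OF g]] by (rule bij_betw_imp_inj_on)
  have "out_arcs T (g v) \<subseteq> arc_map T g ` out_arcs T v"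
  proof
    fix c assume c: "c \<in> out_arcs T (g v)"
    then obtain b where b: "b \<in> arcs T" "c = arc_map T g b"
      using bij by (auto simp: out_arcs_def bij_betw_def)
    then have "g (orig T b) = g v" using c G_hom(3)[OF g] by (simp add: out_arcs_def)
    then have "orig T b = v" using inj_onD[OF inj] wf_graphD(1)[OF wf b(1)] v by blast
    then show "c \<in> arc_map T g ` out_arcs T v" using b by (auto simp: out_arcs_def)
  qed
  moreover have "arc_map T g ` out_arcs T v \<subseteq> out_arcs T (g v)"
    by (auto simp: out_arcs_def G_hom[OF g])
  moreover have "inj_on (arc_map T g) (out_arcs T v)"
    using bij by (auto simp: bij_betw_def out_arcs_def inj_on_def)
  ultimately show ?thesis by (auto simp: bij_betw_def)
qed

text \<open>
  Every vertex is moved by some \<open>t v\<close> to the representative of its orbit; labelling the arcs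
  at \<open>v\<close> through \<open>t v\<close> makes the local action of \<open>g\<close> at \<open>v\<close> that of
  \<open>t (g v) g (t v)\<inverse>\<close>, which stabilises the representative.
\<close>

theorem subset_universal_group:
  assumes s: "orbit_representatives T G s"
    and iso: "lad_isomorphic (assoc_lad T G s) \<Delta>"
  obtains \<L> \<pi>\<^sub>V \<pi>\<^sub>A where "delta_tree \<Delta> T \<L> \<pi>\<^sub>V \<pi>\<^sub>A" "G \<subseteq> universal_group \<Delta> T \<L> \<pi>\<^sub>V \<pi>\<^sub>A"
proof -
  let ?Q = "quotient_graph T G" and ?A = "assoc_lad T G s"
  let ?O = "vertex_orbit T G" and ?OA = "arc_orbit T G"
  have base: "base ?A = ?Q" by (simp add: assoc_lad_def)
  note q = graph_homD[OF quotient_hom]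
  have verts_Q: "verts ?Q = ?O ` verts T" and arcs_Q: "arcs ?Q = ?OA ` arcs T"
    by (auto simp: quotient_graph_def)
  obtain \<theta>\<^sub>V \<theta>\<^sub>A \<phi> where \<theta>: "graph_iso ?Q (base \<Delta>) \<theta>\<^sub>V \<theta>\<^sub>A"
    and \<phi>: "\<And>v. v \<in> verts ?Q \<Longrightarrow> bij_betw (\<phi> v) (vertex_colours ?A v) (vertex_colours \<Delta> (\<theta>\<^sub>V v))"
      "\<And>v a. v \<in> verts ?Q \<Longrightarrow> a \<in> out_arcs ?Q v \<Longrightarrow>
        bij_betw (\<phi> v) (colours ?A a) (colours \<Delta> (\<theta>\<^sub>A a))"
    and \<phi>_group: "\<And>v. v \<in> verts ?Q \<Longrightarrow> conj_perm (\<phi> v) (vertex_colours ?A v) (vertex_colours \<Delta> (\<theta>\<^sub>V v))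
        ` local_group ?A v = local_group \<Delta> (\<theta>\<^sub>V v)"
    using iso unfolding lad_isomorphic_def base by metis
  note \<theta>_hom = graph_homD[OF graph_isoD(1)[OF \<theta>]] and \<theta>_bij = graph_isoD(2,3)[OF \<theta>]
  have s_verts: "s V \<in> verts T" and s_orbit: "?O (s V) = V" if "V \<in> verts ?Q" for V
    using s that by (auto simp: orbit_representatives_def)
  have colours: "colours ?A a = {b \<in> out_arcs T (s V). ?OA b = a}" if "a \<in> out_arcs ?Q V" for a V
    using that by (auto simp: assoc_lad_def out_arcs_def)
  have vertex_colours: "vertex_colours ?A V = out_arcs T (s V)" if V: "V \<in> verts ?Q" for V
  proof -
    have "vertex_colours ?A V = (\<Union>a\<in>out_arcs ?Q V. {b \<in> out_arcs T (s V). ?OA b = a})"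
      unfolding vertex_colours_def base using colours by blast
    moreover have "?OA b \<in> out_arcs ?Q V" if "b \<in> out_arcs T (s V)" for b
      using that q(2,3) s_orbit[OF V] by (auto simp: out_arcs_def)
    ultimately show ?thesis by blast
  qed
  have "\<exists>t\<in>G. t v = s (?O v)" if v: "v \<in> verts T" for v
  proof -
    have "?O v \<in> verts ?Q" using q(1)[OF v] .
    then have "s (?O v) \<in> ?O v" using vertex_orbit_self s_verts s_orbit by metis
    then show ?thesis by (auto simp: vertex_orbit_eq)
  qed
  then obtain t where t: "\<And>v. v \<in> verts T \<Longrightarrow> t v \<in> G" "\<And>v. v \<in> verts T \<Longrightarrow> t v v = s (?O v)"
    by metis
  define \<pi>\<^sub>V where "\<pi>\<^sub>V v = \<theta>\<^sub>V (?O v)" for v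
  define \<pi>\<^sub>A where "\<pi>\<^sub>A a = \<theta>\<^sub>A (?OA a)" for a
  \<comment> \<open>The colours of the associated diagram are themselves arcs at representatives. So
    the transported arc is already a colour there, and \<phi> only translates it into a colour of
    \<Delta>.\<close>
  define \<L> where "\<L> b = \<phi> (?O (orig T b)) (arc_map T (t (orig T b)) b)" for b
  have hom: "graph_hom T (base \<Delta>) \<pi>\<^sub>V \<pi>\<^sub>A"
    unfolding \<pi>\<^sub>V_def \<pi>\<^sub>A_def using graph_hom_comp[OF quotient_hom graph_isoD(1)[OF \<theta>]] .
  have move: "bij_betw (arc_map T (t v)) (out_arcs T v) (out_arcs T (s (?O v)))" if v: "v \<in> verts T" for v
    using out_arcs_act[OF t(1)[OF v] v] by (simp add: t(2)[OF v])
  have label_bij: "bij_betw \<L> {b \<in> out_arcs T v. \<pi>\<^sub>A b = a} (colours \<Delta> a)"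
    if v: "v \<in> verts T" and a: "a \<in> out_arcs (base \<Delta>) (\<pi>\<^sub>V v)" for v a
  proof -
    have "a \<in> arcs (base \<Delta>)" using a by (simp add: out_arcs_def)
    then obtain A where A: "A \<in> arcs ?Q" "a = \<theta>\<^sub>A A" using \<theta>_bij(2) by (auto simp: bij_betw_def)
    have "orig ?Q A \<in> verts ?Q" using A(1) q(3) q(1) wf_graphD(1)[OF wf] unfolding arcs_Q by auto
    moreover have "\<theta>\<^sub>V (orig ?Q A) = \<theta>\<^sub>V (?O v)"
      using a A \<theta>_hom(3) by (auto simp: out_arcs_def \<pi>\<^sub>V_def)
    ultimately have "orig ?Q A = ?O v"
      using inj_onD[OF bij_betw_imp_inj_on[OF \<theta>_bij(1)]] q(1)[OF v] by blast
    then have AO: "A \<in> out_arcs ?Q (?O v)" using A(1) by (simp add: out_arcs_def)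
    have sets: "{b \<in> out_arcs T v. \<pi>\<^sub>A b = a} = {b \<in> out_arcs T v. ?OA b = A}"
      using inj_onD[OF bij_betw_imp_inj_on[OF \<theta>_bij(2)]] q(2) A by (auto simp: \<pi>\<^sub>A_def out_arcs_def)
    \<comment> \<open>Moving by an element of \<open>G\<close> does not change arc orbits, so the
      bijection between the arcs at \<open>v\<close> and those at the representative restricts to
      each colour.\<close>
    have "?OA (arc_map T (t v) b) = ?OA b" if "b \<in> out_arcs T v" for b
      using arc_orbit_act[OF t(1)[OF v]] that by (simp add: out_arcs_def)
    then have "arc_map T (t v) ` {b \<in> out_arcs T v. ?OA b = A}
        = {c \<in> arc_map T (t v) ` out_arcs T v. ?OA c = A}"
      by (auto intro!: imageI)
    then have "bij_betw (arc_map T (t v)) {b \<in> out_arcs T v. ?OA b = A} {b \<in> out_arcs T (s (?O v)). ?OA b = A}"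
      using move[OF v] by (auto simp: bij_betw_def inj_on_def)
    then have "bij_betw (\<phi> (?O v) \<circ> arc_map T (t v)) {b \<in> out_arcs T v. ?OA b = A} (colours \<Delta> a)"
      using \<phi>(2)[OF q(1)[OF v] AO] unfolding colours[OF AO] A(2) by (rule bij_betw_trans)
    then show ?thesis
      unfolding sets by (rule bij_betw_cong[THEN iffD1, rotated]) (auto simp: \<L>_def out_arcs_def)
  qed
  have "\<L> b \<in> (\<Union>a\<in>arcs (base \<Delta>). colours \<Delta> a)" if b: "b \<in> arcs T" for b
  proof -
    have "\<pi>\<^sub>A b \<in> out_arcs (base \<Delta>) (\<pi>\<^sub>V (orig T b))"
      using graph_homD(2,3)[OF hom b] by (simp add: out_arcs_def)
    from label_bij[OF wf_graphD(1)[OF wf b] this] b show ?thesis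
      using graph_homD(2)[OF hom b] by (auto simp: bij_betw_def out_arcs_def)
  qed
  moreover have "\<pi>\<^sub>V ` verts T = verts (base \<Delta>)" "\<pi>\<^sub>A ` arcs T = arcs (base \<Delta>)"
    using \<theta>_bij unfolding verts_Q arcs_Q by (auto simp: bij_betw_def \<pi>\<^sub>V_def \<pi>\<^sub>A_def image_image)
  ultimately have D: "delta_tree \<Delta> T \<L> \<pi>\<^sub>V \<pi>\<^sub>A"
    unfolding delta_tree_def using tree hom label_bij by blast
  have "g \<in> universal_group \<Delta> T \<L> \<pi>\<^sub>V \<pi>\<^sub>A" if g: "g \<in> G" for g
  proof -
    have "local_action \<Delta> T \<L> \<pi>\<^sub>V v g \<in> local_group \<Delta> (\<pi>\<^sub>V v)" if v: "v \<in> verts T" for v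
    proof -
      let ?V = "?O v"
      let ?S = "out_arcs T (s ?V)" and ?X = "vertex_colours \<Delta> (\<pi>\<^sub>V v)"
      have V: "?V \<in> verts ?Q" using q(1)[OF v] .
      have gv: "g v \<in> verts T" "?O (g v) = ?V" using G_hom(1)[OF g v] vertex_orbit_act[OF g v] by auto
      have \<phi>V: "bij_betw (\<phi> ?V) ?S ?X" using \<phi>(1)[OF V] by (simp add: vertex_colours[OF V] \<pi>\<^sub>V_def)
      obtain t' where t': "t' \<in> G" "\<And>u. u \<in> verts T \<Longrightarrow> t' (t v u) = u"
        using G_inverse[OF t(1)[OF v]] by metis
      define h where "h = compose (verts T) (t (g v)) (compose (verts T) g t')"
      have h: "h \<in> G" unfolding h_def using G_compose t(1) gv(1) g t'(1) by blast
      have h_t: "h (t v u) = t (g v) (g u)" if "u \<in> verts T" for u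
        using that G_hom(1)[OF t(1)[OF v] that] by (simp add: h_def compose_def t'(2))
      \<comment> \<open>\<open>v\<close> and \<open>g v\<close> lie in one orbit, hence
        \<open>t v\<close> and \<open>t (g v)\<close> lead to the same representative.\<close>
      have "h (s ?V) = s ?V" using h_t[OF v] t(2)[OF v] t(2)[OF gv(1)] gv(2) by simp
      then have h_stab: "h \<in> stabilizer (perm_group (verts T) G) (\<lambda>g. g) (s ?V)"
        using h by (simp add: stabilizer_def)
      \<comment> \<open>A set lies in its closure only if it lies in the underlying space. So every
        permutation induced by the stabiliser, not just that of \<open>h\<close>, must be shown to
        be in \<open>Bij ?S\<close>.\<close>
      have "restrict (arc_map T k) ?S \<in> Bij ?S"
        if "k \<in> stabilizer (perm_group (verts T) G) (\<lambda>g. g) (s ?V)" for k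
      proof -
        have "k \<in> G" "k (s ?V) = s ?V" using that by (auto simp: stabilizer_def)
        then have "bij_betw (arc_map T k) ?S ?S" using out_arcs_act[OF _ s_verts[OF V], of k] by metis
        then show ?thesis by (simp add: Bij_def cong: bij_betw_cong)
      qed
      then have "restrict (arc_map T h) ?S \<in> local_group ?A ?V"
        using h_stab by (auto simp: assoc_lad_def intro!: subsetD[OF closure_of_subset])
      then have "conj_perm (\<phi> ?V) ?S ?X (restrict (arc_map T h) ?S) \<in> local_group \<Delta> (\<pi>\<^sub>V v)"
        using \<phi>_group[OF V] by (auto simp: vertex_colours[OF V] \<pi>\<^sub>V_def)
      moreover have "local_action \<Delta> T \<L> \<pi>\<^sub>V v g = conj_perm (\<phi> ?V) ?S ?X (restrict (arc_map T h) ?S)"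
      proof (rule extensionalityI[where A = ?X])
        fix x assume x: "x \<in> ?X"
        have bij: "bij_betw (\<phi> ?V \<circ> arc_map T (t v)) (out_arcs T v) ?X"
          using move[OF v] \<phi>V by (rule bij_betw_trans)
        have "bij_betw \<L> (out_arcs T v) ?X"
          using bij by (rule bij_betw_cong[THEN iffD1, rotated]) (auto simp: \<L>_def out_arcs_def)
        then obtain b where b: "b \<in> out_arcs T v" "x = \<L> b" "inv_into (out_arcs T v) \<L> x = b"
          using x by (metis bij_betw_def imageE inv_into_f_f)
        then have b': "b \<in> arcs T" "orig T b = v" by (auto simp: out_arcs_def)
        \<comment> \<open>\<open>h_t\<close> at both endpoints of \<open>b\<close> shows that the
          two arcs have the same ends.\<close>
        have ht: "arc_map T h (arc_map T (t v) b) = arc_map T (t (g v)) (arc_map T g b)"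
          using aut_G h b'(1) wf_graphD[OF wf b'(1)]
          by (intro arc_map_eqI[OF simple])
            (auto simp: G_hom[OF g] G_hom[OF t(1)[OF v]] G_hom[OF t(1)[OF gv(1)]] h_t)
        have tb: "arc_map T (t v) b \<in> ?S" using move[OF v] b(1) by (auto simp: bij_betw_def)
        have "local_action \<Delta> T \<L> \<pi>\<^sub>V v g x = \<phi> ?V (arc_map T (t (g v)) (arc_map T g b))"
          using x b(3) by (simp add: local_action_def \<L>_def G_hom[OF g] b' gv(2))
        also have "\<dots> = conj_perm (\<phi> ?V) ?S ?X (restrict (arc_map T h) ?S) (\<phi> ?V (arc_map T (t v) b))"
          using conj_perm_apply[OF \<phi>V tb] tb ht by simp
        also have "\<phi> ?V (arc_map T (t v) b) = x" using b(2) b'(2) by (simp add: \<L>_def)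
        finally show "local_action \<Delta> T \<L> \<pi>\<^sub>V v g x = conj_perm (\<phi> ?V) ?S ?X (restrict (arc_map T h) ?S) x" .
      qed (auto simp: local_action_def conj_perm_def)
      ultimately show ?thesis by simp
    qed
    then show ?thesis
      using g aut_G vertex_orbit_act[OF g] arc_orbit_act[OF g]
      by (auto simp: universal_group_def graph_aut_over_def \<pi>\<^sub>V_def \<pi>\<^sub>A_def)
  qed
  with D that show ?thesis by blast
qed

end

theorem corollary17:
  fixes \<Delta> :: "('w, 'b, 'x) lad"
    and T :: "('v, 'a) graph"
    and \<L> :: "'a \<Rightarrow> 'x"
    and \<pi>\<^sub>V :: "'v \<Rightarrow> 'w"
    and \<pi>\<^sub>A :: "'a \<Rightarrow> 'b"
    and G :: "('v \<Rightarrow> 'v) set"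
    and s :: "'v set \<Rightarrow> 'v"
  assumes "local_action_diagram \<Delta>"
    and "delta_tree \<Delta> T \<L> \<pi>\<^sub>V \<pi>\<^sub>A"
    and "subgroup G (BijGroup (verts T))" and "G \<subseteq> graph_aut T"
    and "orbit_representatives T G s"
    and "lad_isomorphic (assoc_lad T G s) \<Delta>"
  shows "\<exists>H. subgroup H (BijGroup (verts T)) \<and> H \<subseteq> universal_group \<Delta> T \<L> \<pi>\<^sub>V \<pi>\<^sub>A \<and>
           perm_isomorphic (verts T) G (verts T) H"
proof -
  interpret tree_action T G
    using assms(3,4) delta_treeD(1)[OF assms(2)] by (simp add: tree_action_def)
  obtain \<L>' \<pi>\<^sub>V' \<pi>\<^sub>A' where D': "delta_tree \<Delta> T \<L>' \<pi>\<^sub>V' \<pi>\<^sub>A'"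
    and G: "G \<subseteq> universal_group \<Delta> T \<L>' \<pi>\<^sub>V' \<pi>\<^sub>A'"
    using subset_universal_group[OF assms(5,6)] by metis
  \<comment> \<open>Both structures live on the same tree, so \<open>\<psi>\<^sub>V\<close> permutes
    \<open>verts T\<close> and the conjugate of \<open>G\<close> is again a group of permutations of
    \<open>verts T\<close>.\<close>
  obtain \<psi>\<^sub>V \<psi>\<^sub>A \<gamma> where \<psi>: "graph_iso T T \<psi>\<^sub>V \<psi>\<^sub>A"
    "\<And>v. v \<in> verts T \<Longrightarrow> \<pi>\<^sub>V (\<psi>\<^sub>V v) = \<pi>\<^sub>V' v" "\<And>b. b \<in> arcs T \<Longrightarrow> \<pi>\<^sub>A (\<psi>\<^sub>A b) = \<pi>\<^sub>A' b"
    "\<And>v. v \<in> verts T \<Longrightarrow> \<gamma> v \<in> local_group \<Delta> (\<pi>\<^sub>V' v)"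
    "\<And>b. b \<in> arcs T \<Longrightarrow> \<L> (\<psi>\<^sub>A b) = \<gamma> (orig T b) (\<L>' b)"
    by (rule delta_tree_unique[OF assms(1,2) D']) blast
  let ?H = "conj_perm \<psi>\<^sub>V (verts T) (verts T) ` G"
  note bij = graph_isoD(2)[OF \<psi>(1)]
  have "subgroup ?H (BijGroup (verts T))"
    using group_hom.subgroup_img_is_subgroup[OF conj_perm_hom[OF bij] assms(3)] .
  moreover have "?H \<subseteq> universal_group \<Delta> T \<L> \<pi>\<^sub>V \<pi>\<^sub>A"
    using conj_perm_universal_group[OF assms(1,2) D' \<psi>] G by blast
  moreover have "perm_isomorphic (verts T) G (verts T) ?H"
    using bij by (auto simp: perm_isomorphic_def)
  ultimately show ?thesis by blast
qed

end
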